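(* Let $\mathbb{T}$ be a time scale and let $\{W_t\}$ be a Brownian motion indexed by $\mathbb{T}$ on a filtered probability space $(\Omega,\mathcal{F}_t,\mathbb{P})$. Let $f:\mathbb{T}\times\mathbb{R}\to\mathbb{R}$ be such that $f^\Delta(t,x)$, $f^{\Delta^2}(t,x)$, $\frac{\partial f}{\partial x}(t,x)$, $\frac{\partial^2 f}{\partial x^2}(t,x)$, $\frac{\partial f^\Delta}{\partial x}(t,x)$ and $\frac{\partial^2 f^\Delta}{\partial x^2}(t,x)$ are continuous on $\mathbb{T}\times\mathbb{R}$. Then for any $t_1\le t_2$ with $t_1,t_2\in[0,\infty)\cap\mathbb{T}$, $$\begin{aligned} f(t_2,W_{t_2})-f(t_1,W_{t_1}) =&\int_{t_1}^{t_2} f^\Delta(s,W_s)\,\Delta s+\int_{t_1}^{t_2}\frac{\partial f}{\partial x}(s,W_s)\,\Delta W_s+\frac12\int_{t_1}^{t_2}\frac{\partial^2 f}{\partial x^2}(s,W_s)\,\Delta s\\ &+\sum_{I\in\mathcal{I},\, I\subset(t_1,t_2)}\Big[f(s_I^+,W_{s_I^+})-f(s_I^+,W_{s_I^-})-\frac{\partial f}{\partial x}(s_I^-,W_{s_I^-})(W_{s_I^+}-W_{s_I^-})-\frac12\frac{\partial^2 f}{\partial x^2}(s_I^-,W_{s_I^-})(s_I^+-s_I^-)\Big].\end{aligned}$$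
   Context: A time scale $\mathbb{T}$ is a nonempty closed subset of $\mathbb{R}$; $A_{\mathbb{T}}=A\cap\mathbb{T}$. Forward/backward jumps: $\sigma(t)=\inf\{s\in\mathbb{T}:s>t\}$, $\rho(t)=\sup\{s\in\mathbb{T}:s<t\}$. For $g:\mathbb{T}\to\mathbb{R}$ and $t\in\mathbb{T}$ (not a left-scattered maximum), the delta (Hilger) derivative $g^\Delta(t)$ is the number such that for every $\varepsilon>0$ there is $\delta>0$ with $|[g(\sigma(t))-g(s)]-g^\Delta(t)[\sigma(t)-s]|\le\varepsilon|\sigma(t)-s|$ for all $s\in(t-\delta,t+\delta)\cap\mathbb{T}$; $f^\Delta(t,x)$, $f^{\Delta^2}(t,x)$ denote first and second delta derivatives of $f$ in $t$. A Brownian motion indexed by $\mathbb{T}$ is an adapted process $\{W_t\}_{t\in\mathbb{T}\cup\{0\}}$ with $W_0=0$ a.s., such that for $s<t$ in $\mathbb{T}$ the increment $W_t-W_s$ is independent of $\mathcal{F}_s$ and normally distributed with mean $0$ and variance $t-s$, and $W$ is a.s. continuous on $\mathbb{T}$. For a random function $g:[0,\infty)_{\mathbb{T}}\times\Omega\to\mathbb{R}$ define its extension $\tilde g(t,\omega)=g(\sup[0,t]_{\mathbb{T}},\omega)$, $t\ge 0$. Delta integrals are defined by $\int_a^b g(t)\,\Delta t=\int_a^b\tilde g(t)\,dt$ (ordinary Lebesgue/Riemann integral) and, for $L^2$ progressively measurable $g$, $\int_a^b g(t)\,\Delta W_t=\int_a^b \tilde g(t)\,dW_t$ (ordinary Itô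 integral, with respect to the Brownian motion on $[0,\infty)$ whose values on $\mathbb{T}$ are $W$). $\mathcal{I}$ denotes the (at most countable) collection of open intervals $I=(s_I^-,s_I^+)$ with $s_I^-<s_I^+$, $s_I^-,s_I^+\in\mathbb{T}$ and $I\cap\mathbb{T}=\emptyset$ (equivalently $s_I^+=\sigma(s_I^-)>s_I^-$). *)

theory Defs
  imports "HOL-Probability.Probability"
begin

definition time_scale :: "real set \<Rightarrow> bool" where
  "time_scale T \<longleftrightarrow> T \<noteq> {} \<and> closed T"

text \<open>Forward and backward jump operators (with the usual conventions
  inf {} = sup T, sup {} = inf T realised as sigma t = t resp. rho t = t).\<close>
definition ts_sigma :: "real set \<Rightarrow> real \<Rightarrow> real" where
  "ts_sigma T t = (if \<exists>s\<in>T. s > t then Inf {s\<in>T. s > t} else t)"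

definition ts_rho :: "real set \<Rightarrow> real \<Rightarrow> real" where
  "ts_rho T t = (if \<exists>s\<in>T. s < t then Sup {s\<in>T. s < t} else t)"

definition ts_kappa :: "real set \<Rightarrow> real set" where
  "ts_kappa T = {t\<in>T. \<not> ((\<forall>s\<in>T. s \<le> t) \<and> ts_rho T t < t)}"

definition has_delta_derivative :: "real set \<Rightarrow> (real \<Rightarrow> real) \<Rightarrow> real \<Rightarrow> real \<Rightarrow> bool" where
  "has_delta_derivative T g D t \<longleftrightarrow>
     (\<forall>\<epsilon>>0. \<exists>\<delta>>0. \<forall>s\<in>T. \<bar>s - t\<bar> < \<delta> \<longrightarrow>
        \<bar>(g (ts_sigma T t) - g s) - D * (ts_sigma T t - s)\<bar> \<le> \<epsilon> * \<bar>ts_sigma T t - s\<bar>)"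

text \<open>Extension point: sup [0,t]_T; the extension of g is g (ts_ext T t).\<close>
definition ts_ext :: "real set \<Rightarrow> real \<Rightarrow> real" where
  "ts_ext T t = Sup {s\<in>T. 0 \<le> s \<and> s \<le> t}"

text \<open>Left endpoints s_I^- of the gaps I = (s_I^-, s_I^+) contained in (t1,t2).\<close>
definition ts_gaps_in :: "real set \<Rightarrow> real \<Rightarrow> real \<Rightarrow> real set" where
  "ts_gaps_in T t1 t2 = {a\<in>T. a < ts_sigma T a \<and> t1 \<le> a \<and> ts_sigma T a \<le> t2}"

definition filtration_of :: "'a measure \<Rightarrow> (real \<Rightarrow> 'a measure) \<Rightarrow> bool" where
  "filtration_of M F \<longleftrightarrow> filtration (space M) F \<and> (\<forall>t. sets (F t) \<subseteq> sets M)"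

definition brownian_motion :: "'a measure \<Rightarrow> (real \<Rightarrow> 'a measure) \<Rightarrow> (real \<Rightarrow> 'a \<Rightarrow> real) \<Rightarrow> bool" where
  "brownian_motion M F B \<longleftrightarrow>
     prob_space M \<and> filtration_of M F \<and>
     (AE \<omega> in M. B 0 \<omega> = 0) \<and>
     (\<forall>t\<ge>0. B t \<in> borel_measurable (F t)) \<and>
     (\<forall>s t. 0 \<le> s \<and> s < t \<longrightarrow>
        distributed M lborel (\<lambda>\<omega>. B t \<omega> - B s \<omega>) (normal_density 0 (sqrt (t - s))) \<and>
        (\<forall>A\<in>sets (F s). \<forall>C\<in>sets borel.
           measure M (A \<inter> ((\<lambda>\<omega>. B t \<omega> - B s \<omega>) -` C \<inter> space M))
             = measure M A * measure M ((\<lambda>\<omega>. B t \<omega> - B s \<omega>) -` C \<inter> space M))) \<and>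
     (AE \<omega> in M. continuous_on {0..} (\<lambda>t. B t \<omega>))"

definition conv_in_prob :: "'a measure \<Rightarrow> (nat \<Rightarrow> 'a \<Rightarrow> real) \<Rightarrow> ('a \<Rightarrow> real) \<Rightarrow> bool" where
  "conv_in_prob M Y Z \<longleftrightarrow>
     (\<forall>\<epsilon>>0. (\<lambda>n. measure M {\<omega>\<in>space M. \<bar>Y n \<omega> - Z \<omega>\<bar> > \<epsilon>}) \<longlonglongrightarrow> 0)"

definition simple_adapted ::
  "(real \<Rightarrow> 'a measure) \<Rightarrow> real \<Rightarrow> real \<Rightarrow> nat \<Rightarrow> (nat \<Rightarrow> real) \<Rightarrow> (nat \<Rightarrow> 'a \<Rightarrow> real) \<Rightarrow> bool" where
  "simple_adapted F a b m r xi \<longleftrightarrow>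
     r 0 = a \<and> r m = b \<and> (\<forall>k<m. r k < r (Suc k)) \<and>
     (\<forall>k<m. xi k \<in> borel_measurable (F (r k)))"

definition simple_proc :: "nat \<Rightarrow> (nat \<Rightarrow> real) \<Rightarrow> (nat \<Rightarrow> 'a \<Rightarrow> real) \<Rightarrow> real \<Rightarrow> 'a \<Rightarrow> real" where
  "simple_proc m r xi s \<omega> = (\<Sum>k<m. indicator {r k..<r (Suc k)} s * xi k \<omega>)"

definition simple_ito :: "(real \<Rightarrow> 'a \<Rightarrow> real) \<Rightarrow> nat \<Rightarrow> (nat \<Rightarrow> real) \<Rightarrow> (nat \<Rightarrow> 'a \<Rightarrow> real) \<Rightarrow> 'a \<Rightarrow> real" where
  "simple_ito B m r xi \<omega> = (\<Sum>k<m. xi k \<omega> * (B (r (Suc k)) \<omega> - B (r k) \<omega>))"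

text \<open>X is (a version of) the Ito integral of g over [a,b] w.r.t. B: the limit in
  probability of Ito integrals of simple adapted processes approximating g in the
  sense that the pathwise integral of (phi_n - g)^2 over [a,b] tends to 0 in
  probability. For L^2 progressively measurable g this is the usual L^2 Ito
  integral (up to a.s. equality).\<close>
definition is_ito_integral ::
  "'a measure \<Rightarrow> (real \<Rightarrow> 'a measure) \<Rightarrow> (real \<Rightarrow> 'a \<Rightarrow> real) \<Rightarrow> real \<Rightarrow> real \<Rightarrow> (real \<Rightarrow> 'a \<Rightarrow> real) \<Rightarrow> ('a \<Rightarrow> real) \<Rightarrow> bool" where
  "is_ito_integral M F B a b g X \<longleftrightarrow>
     X \<in> borel_measurable M \<and>
     (\<exists>m r xi. (\<forall>n. simple_adapted F a b (m n) (r n) (xi n)) \<and>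
        conv_in_prob M (\<lambda>n \<omega>. LBINT s:{a..b}. (simple_proc (m n) (r n) (xi n) s \<omega> - g s \<omega>)\<^sup>2) (\<lambda>_. 0) \<and>
        conv_in_prob M (\<lambda>n. simple_ito B (m n) (r n) (xi n)) X)"

end

theory Submission
  imports Defs
begin

text \<open>
  Partition \<open>[t1, t2]\<close> by points of the time scale so that every step either is shorter than
  \<open>\<delta>\<close> (a short step) or is a gap. Over a long gap the increment of \<open>f (t, W t)\<close> is, by
  definition, the summand of the jump series plus the Ito, time and second order terms. Over a
  short step \<open>[s, t]\<close>, Taylor's formula in space leaves three errors besides these terms:
  \<open>(fx t (W s) - fx s (W s)) * \<Delta>W\<close>, \<open>1/2 * fxx s (W s) * ((\<Delta>W)\<^sup>2 - (t - s))\<close> and a remainder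
  dominated by a small multiple of \<open>(\<Delta>W)\<^sup>2\<close>. The first two are sums of orthogonal martingale
  differences and vanish in probability after truncation; the third one does because the sum of
  the \<open>(\<Delta>W)\<^sup>2\<close> is bounded in \<open>L\<^sup>1\<close>. The remaining terms converge path by path, and the jump
  series converges absolutely since its terms are \<open>O((t - s) + (\<Delta>W)\<^sup>2)\<close>.
\<close>

section \<open>Calculus on time scales\<close>

text \<open>The Taylor expansion takes place at the right endpoint \<open>t\<close> of a step, after
  the time increment has been taken with the space variable frozen at \<open>W s\<close>. An Ito sum
  needs the coefficient \<open>fx s\<close> instead of \<open>fx t\<close>, and this correction is
  the obstacle: \<open>fx t - fx s\<close> is uniformly small, but it multiplies increments whose
  absolute values need not have bounded sums as the partition is refined. No bound path by path is
  available, and orthogonality has to replace it. The stochastic integral is not constructed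
  beforehand. All other terms of the discrete identity converge, hence so do the Ito sums, and their
  limit serves as the integral; the same partitions supply the simple processes that
  \<open>is_ito_integral\<close> asks for. A gap longer than \<delta> cannot be subdivided, so the
  longest step need not tend to 0. Riemann sums converge nevertheless, because the extended
  integrand is constant over a gap.\<close>

lemma ts_sigma_props:
  assumes "closed T" "a \<in> T" "b \<in> T" "a < b"
  shows "ts_sigma T a \<in> T" "a \<le> ts_sigma T a" "ts_sigma T a \<le> b"
    "\<And>s. s \<in> T \<Longrightarrow> a < s \<Longrightarrow> ts_sigma T a \<le> s"
proof -
  let ?S = "{s\<in>T. s > a}"
  have eq: "ts_sigma T a = Inf ?S" using assms by (auto simp: ts_sigma_def)
  have ne: "?S \<noteq> {}" using assms by auto
  have bdd: "bdd_below ?S" by (rule bdd_belowI[of _ a]) auto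
  have "Inf ?S \<in> closure ?S" by (rule closure_contains_Inf[OF ne bdd])
  also have "closure ?S \<subseteq> T" by (rule closure_minimal) (use assms in auto)
  finally show "ts_sigma T a \<in> T" using eq by simp
  show "a \<le> ts_sigma T a" unfolding eq by (rule cInf_greatest[OF ne]) auto
  show *: "ts_sigma T a \<le> s" if "s \<in> T" "a < s" for s
    unfolding eq by (rule cInf_lower[OF _ bdd]) (use that in auto)
  show "ts_sigma T a \<le> b" by (rule *) fact+
qed

lemma ts_sigma_eqI:
  assumes "closed T" "a \<in> T" "b \<in> T" "a < b" "{a<..<b} \<inter> T = {}"
  shows "ts_sigma T a = b"
proof -
  have "b \<le> Inf {s\<in>T. s > a}"
    by (rule cInf_greatest) (use assms in \<open>auto simp: not_less[symmetric]\<close>)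
  moreover have "ts_sigma T a = Inf {s\<in>T. s > a}" using assms by (auto simp: ts_sigma_def)
  ultimately show ?thesis using ts_sigma_props(3)[OF assms(1-4)] by simp
qed

lemma ts_kappaI:
  assumes "a \<in> T" "b \<in> T" "a < b"
  shows "a \<in> ts_kappa T"
  using assms by (force simp: ts_kappa_def)

text \<open>Removing a left-scattered maximum leaves the part of \<open>T\<close> up to
  \<open>ts_rho T t\<close>, still a closed set. Closedness makes bounded pieces of
  \<open>ts_kappa T\<close> compact, as uniform continuity of \<open>fd\<close> and boundedness of
  \<open>fdx\<close> require.\<close>

lemma closed_ts_kappa:
  assumes "closed T"
  shows "closed (ts_kappa T)"
proof (cases "\<exists>t\<in>T. (\<forall>s\<in>T. s \<le> t) \<and> ts_rho T t < t")
  case True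
  then obtain t where t: "t \<in> T" "\<And>s. s \<in> T \<Longrightarrow> s \<le> t" "ts_rho T t < t" by auto
  have "s \<le> ts_rho T t" if "s \<in> T" "s \<noteq> t" for s
  proof -
    have "s < t" using t(2)[of s] that by simp
    hence "ts_rho T t = Sup {s\<in>T. s < t}" using that by (auto simp: ts_rho_def)
    moreover have "s \<le> Sup {s\<in>T. s < t}"
      by (rule cSup_upper) (use that \<open>s < t\<close> in \<open>auto intro!: bdd_aboveI[of _ t]\<close>)
    ultimately show ?thesis by simp
  qed
  hence "ts_kappa T = T \<inter> {..ts_rho T t}"
    using t by (fastforce simp: ts_kappa_def)
  thus ?thesis using assms by auto
next
  case False
  hence "ts_kappa T = T" by (auto simp: ts_kappa_def)
  thus ?thesis using assms by simp
qed

lemma ts_ext_props: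
  assumes "closed T" "t1 \<in> T" "0 \<le> t1" "t1 \<le> s"
  shows "ts_ext T s \<in> T" "t1 \<le> ts_ext T s" "ts_ext T s \<le> s"
    "\<And>u. u \<in> T \<Longrightarrow> 0 \<le> u \<Longrightarrow> u \<le> s \<Longrightarrow> u \<le> ts_ext T s"
proof -
  let ?S = "{u\<in>T. 0 \<le> u \<and> u \<le> s}"
  have eq: "ts_ext T s = Sup ?S" by (simp add: ts_ext_def)
  have ne: "?S \<noteq> {}" using assms by auto
  have bdd: "bdd_above ?S" by (rule bdd_aboveI[of _ s]) auto
  have "Sup ?S \<in> closure ?S" by (rule closure_contains_Sup[OF ne bdd])
  also have "closure ?S \<subseteq> T" by (rule closure_minimal) (use assms in auto)
  finally show "ts_ext T s \<in> T" using eq by simp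
  show "ts_ext T s \<le> s" unfolding eq by (rule cSup_least[OF ne]) auto
  show *: "u \<le> ts_ext T s" if "u \<in> T" "0 \<le> u" "u \<le> s" for u
    unfolding eq by (rule cSup_upper[OF _ bdd]) (use that in auto)
  show "t1 \<le> ts_ext T s" by (rule *) fact+
qed

text \<open>The point \<open>s = t\<close> is admissible in the definition whatever \<delta> is, so
  the error is at most every positive multiple of a fixed length. At a right-scattered point the
  derivative is therefore an exact difference quotient.\<close>

lemma delta_derivative_scattered:
  assumes "has_delta_derivative T g D t" "t \<in> T"
  shows "g (ts_sigma T t) - g t = D * (ts_sigma T t - t)"
proof -
  let ?d = "\<bar>ts_sigma T t - t\<bar>" and ?x = "\<bar>(g (ts_sigma T t) - g t) - D * (ts_sigma T t - t)\<bar>"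
  have le: "?x \<le> e * ?d" if "e > 0" for e
    using assms that unfolding has_delta_derivative_def by (metis abs_zero diff_self)
  have "?x \<le> 0 + e" if "e > 0" for e
  proof -
    have "?x \<le> e / (?d + 1) * ?d" by (rule le) (use that in simp)
    also have "\<dots> \<le> e" using that by (simp add: field_simps)
    finally show ?thesis by simp
  qed
  hence "?x \<le> 0" by (rule field_le_epsilon)
  thus ?thesis by simp
qed

text \<open>The definition compares \<open>g s\<close> with the value at the jump. Subtracting the
  exact identity for the jump moves the base point to \<open>t\<close> itself; the price is the jump
  length in the error, which vanishes at right-dense points.\<close>

lemma delta_derivative_near:
  assumes "has_delta_derivative T g D t" "t \<in> T" "e > 0"
  obtains d where "d > 0"
    "\<And>s. s \<in> T \<Longrightarrow> \<bar>s - t\<bar> < d \<Longrightarrow> \<bar>g t - g s - D * (t - s)\<bar> \<le> e * (\<bar>ts_sigma T t - t\<bar> + \<bar>t - s\<bar>)"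
proof -
  obtain d where d: "d > 0" "\<forall>s\<in>T. \<bar>s - t\<bar> < d \<longrightarrow>
        \<bar>(g (ts_sigma T t) - g s) - D * (ts_sigma T t - s)\<bar> \<le> e * \<bar>ts_sigma T t - s\<bar>"
    using assms unfolding has_delta_derivative_def by blast
  show ?thesis
  proof (rule that[OF d(1)])
    fix s assume s: "s \<in> T" "\<bar>s - t\<bar> < d"
    have "\<bar>g t - g s - D * (t - s)\<bar> = \<bar>(g (ts_sigma T t) - g s) - D * (ts_sigma T t - s)\<bar>"
      using delta_derivative_scattered[OF assms(1,2)] by (simp add: algebra_simps)
    also have "\<dots> \<le> e * \<bar>ts_sigma T t - s\<bar>" using d s by blast
    also have "\<dots> \<le> e * (\<bar>ts_sigma T t - t\<bar> + \<bar>t - s\<bar>)"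
      using assms by (intro mult_left_mono) auto
    finally show "\<bar>g t - g s - D * (t - s)\<bar> \<le> e * (\<bar>ts_sigma T t - t\<bar> + \<bar>t - s\<bar>)" .
  qed
qed

lemma delta_derivative_continuous:
  assumes "has_delta_derivative T g D t" "t \<in> T"
  shows "continuous (at t within T) g"
  unfolding continuous_within_eps_delta
proof (intro allI impI)
  fix e :: real assume e: "e > 0"
  let ?u = "\<bar>ts_sigma T t - t\<bar>"
  \<comment> \<open>Half of \<open>e\<close> is spent on the error term, with
    \<open>\<bar>t - s\<bar>\<close> bounded by 1, and half on the linear term
    \<open>D * (t - s)\<close>.\<close>
  define e' where "e' = e / (2 * (?u + 1))"
  have e': "e' > 0" using e by (simp add: e'_def add_nonneg_pos)
  obtain d where d: "d > 0"
    "\<And>s. s \<in> T \<Longrightarrow> \<bar>s - t\<bar> < d \<Longrightarrow> \<bar>g t - g s - D * (t - s)\<bar> \<le> e' * (?u + \<bar>t - s\<bar>)"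
    using delta_derivative_near[OF assms e'] by metis
  define d' where "d' = min (min d 1) (e / (2 * (\<bar>D\<bar> + 1)))"
  have "dist (g s) (g t) < e" if s: "s \<in> T" "dist s t < d'" for s
  proof -
    have s': "\<bar>s - t\<bar> < d" "\<bar>t - s\<bar> < 1" "\<bar>t - s\<bar> < e / (2 * (\<bar>D\<bar> + 1))"
      using s by (auto simp: d'_def dist_real_def)
    have "\<bar>D * (t - s)\<bar> \<le> (\<bar>D\<bar> + 1) * \<bar>t - s\<bar>"
      unfolding abs_mult by (rule mult_right_mono) auto
    also have "\<dots> < e / 2" using s'(3) by (simp add: field_simps)
    finally have 1: "\<bar>D * (t - s)\<bar> < e / 2" .
    have "\<bar>g t - g s - D * (t - s)\<bar> \<le> e' * (?u + \<bar>t - s\<bar>)" using d s s' by blast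
    also have "\<dots> \<le> e' * (?u + 1)" using e' s' by (intro mult_left_mono) auto
    also have "\<dots> = e / 2" by (simp add: e'_def field_simps add_nonneg_eq_0_iff)
    finally show ?thesis using 1 unfolding dist_real_def by linarith
  qed
  moreover have "d' > 0" using d e by (simp add: d'_def add_nonneg_pos)
  ultimately show "\<exists>d>0. \<forall>x'\<in>T. dist x' t < d \<longrightarrow> dist (g x') (g t) < e" by blast
qed

text \<open>\<open>S\<close> collects the points up to which the estimate holds with slack
  \<open>e\<close>. Its supremum belongs to it by continuity, and no point of \<open>S\<close> below
  \<open>b\<close> is the last one: a right-scattered point is left by an exact jump, a right-dense
  one through nearby points of \<open>T\<close>. The bound on \<open>D\<close> is asked for left of
  \<open>b\<close> only, so a gap needs it at its left end alone.\<close>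

lemma delta_mean_value:
  assumes T: "closed T" and ab: "a \<in> T" "b \<in> T" "a \<le> b"
    and D: "\<And>t. t \<in> ts_kappa T \<Longrightarrow> has_delta_derivative T g (D t) t"
    and bd: "\<And>t. t \<in> T \<Longrightarrow> a \<le> t \<Longrightarrow> t < b \<Longrightarrow> \<bar>D t - c\<bar> \<le> \<eta>"
  shows "\<bar>g b - g a - c * (b - a)\<bar> \<le> \<eta> * (b - a)"
proof (rule field_le_epsilon)
  fix e0 :: real assume e0: "e0 > 0"
  define e where "e = e0 / (b - a + 1)"
  have e: "e > 0" using e0 ab by (simp add: e_def)
  define P where "P s \<longleftrightarrow> \<bar>g s - g a - c * (s - a)\<bar> \<le> (\<eta> + e) * (s - a)" for s
  define S where "S = {s \<in> T. a \<le> s \<and> s \<le> b \<and> P s}"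
  define s where "s = Sup S"
  have ne: "S \<noteq> {}" using ab by (auto simp: S_def P_def)
  have bdd: "bdd_above S" by (rule bdd_aboveI[of _ b]) (auto simp: S_def)
  have scl: "s \<in> closure S" unfolding s_def by (rule closure_contains_Sup[OF ne bdd])
  have "closure S \<subseteq> T \<inter> {a..b}" by (rule closure_minimal) (use T in \<open>auto simp: S_def\<close>)
  hence sT: "s \<in> T" "a \<le> s" "s \<le> b" using scl by auto
  have Pstep: "P u" if "P v" "\<bar>D v - c\<bar> \<le> \<eta>" "\<bar>g u - g v - D v * (u - v)\<bar> \<le> e * (u - v)" "v \<le> u" for u v
  proof -
    have "g u - g a - c * (u - a) = (g v - g a - c * (v - a)) + (g u - g v - D v * (u - v)) + (D v - c) * (u - v)"
      by (simp add: algebra_simps)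
    moreover have "\<bar>(D v - c) * (u - v)\<bar> \<le> \<eta> * (u - v)"
      using that by (simp add: abs_mult mult_right_mono)
    ultimately show ?thesis using that unfolding P_def by (simp add: algebra_simps)
  qed
  have Ps: "P s"
  proof (cases "s \<in> S")
    case False
    \<comment> \<open>\<open>s\<close> may be the maximum of \<open>T\<close>. Lying in the closure
      of \<open>S\<close> but outside \<open>S\<close>, it is a limit of smaller points of
      \<open>T\<close>, hence not left-scattered, and the derivative exists there.\<close>
    have "s \<in> ts_kappa T"
    proof -
      have "\<not> (ts_rho T s < s)"
      proof
        assume lt: "ts_rho T s < s"
        obtain u where "u \<in> S" "dist u s < s - ts_rho T s"
          using scl lt unfolding closure_approachable by (metis diff_gt_0_iff_gt)
        hence u: "u \<in> T" "u > ts_rho T s" "u \<le> s" "u \<noteq> s"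
          using False cSup_upper[OF _ bdd, of u] by (auto simp: S_def s_def dist_real_def)
        have "u \<le> Sup {s'\<in>T. s' < s}"
          by (rule cSup_upper) (use u in \<open>auto intro!: bdd_aboveI[of _ s]\<close>)
        moreover have "ts_rho T s = Sup {s'\<in>T. s' < s}"
          unfolding ts_rho_def using u by auto
        ultimately show False using u by simp
      qed
      thus ?thesis using sT by (simp add: ts_kappa_def)
    qed
    hence cont: "continuous (at s within T) g" by (rule delta_derivative_continuous[OF D sT(1)])
    obtain x where x: "\<And>n. x n \<in> S" "x \<longlonglongrightarrow> s" using scl unfolding closure_sequential by auto
    have "(\<lambda>n. g (x n)) \<longlonglongrightarrow> g s"
      using cont x unfolding continuous_within_sequentially by (auto simp: S_def comp_def)
    hence "(\<lambda>n. \<bar>g (x n) - g a - c * (x n - a)\<bar>) \<longlonglongrightarrow> \<bar>g s - g a - c * (s - a)\<bar>"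
      by (intro tendsto_intros x)
    moreover have "(\<lambda>n. (\<eta> + e) * (x n - a)) \<longlonglongrightarrow> (\<eta> + e) * (s - a)" by (intro tendsto_intros x)
    ultimately show ?thesis unfolding P_def
      by (rule LIMSEQ_le) (use x in \<open>auto simp: S_def P_def\<close>)
  qed (simp add: S_def)
  have "s = b"
  proof (rule ccontr)
    assume "s \<noteq> b"
    hence sb: "s < b" using sT by simp
    note sg = ts_sigma_props[OF T sT(1) ab(2) sb]
    have der: "has_delta_derivative T g (D s) s" by (rule D[OF ts_kappaI[OF sT(1) ab(2) sb]])
    have bds: "\<bar>D s - c\<bar> \<le> \<eta>" using bd sT sb by simp
    have "\<exists>u\<in>T. s < u \<and> u \<le> b \<and> \<bar>g u - g s - D s * (u - s)\<bar> \<le> e * (u - s)"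
    proof (cases "s < ts_sigma T s")
      case True
      thus ?thesis using sg(1,3) delta_derivative_scattered[OF der sT(1)] e
        by (intro bexI[of _ "ts_sigma T s"]) auto
    next
      case False
      hence eq: "ts_sigma T s = s" using sg by simp
      obtain d where d: "d > 0"
        "\<And>u. u \<in> T \<Longrightarrow> \<bar>u - s\<bar> < d \<Longrightarrow> \<bar>g s - g u - D s * (s - u)\<bar> \<le> e * (\<bar>ts_sigma T s - s\<bar> + \<bar>s - u\<bar>)"
        using delta_derivative_near[OF der sT(1) e] by metis
      have "Inf {u\<in>T. u > s} < s + d"
        using eq d(1) sb ab(2) unfolding ts_sigma_def by (auto split: if_splits)
      then obtain u where u: "u \<in> T" "s < u" "u < s + d"
        using ab(2) sb by (subst (asm) cInf_less_iff) (auto intro!: bdd_belowI[of _ s])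
      \<comment> \<open>The nearby point may overshoot \<open>b\<close>; then \<open>b\<close>
        itself is within distance \<open>d\<close> of \<open>s\<close>.\<close>
      show ?thesis
      proof (cases "u \<le> b")
        case True
        show ?thesis using d(2)[of u] u True eq by (intro bexI[of _ u]) (auto simp: algebra_simps abs_minus_commute)
      next
        case False
        show ?thesis using d(2)[of b] u False eq sb ab(2)
          by (intro bexI[of _ b]) (auto simp: algebra_simps abs_minus_commute)
      qed
    qed
    then obtain u where u: "u \<in> T" "s < u" "u \<le> b" "\<bar>g u - g s - D s * (u - s)\<bar> \<le> e * (u - s)" by auto
    hence "u \<in> S" using Pstep[OF Ps bds u(4)] sT by (auto simp: S_def)
    hence "u \<le> s" unfolding s_def by (rule cSup_upper[OF _ bdd])
    thus False using u by simp
  qed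
  with Ps have "\<bar>g b - g a - c * (b - a)\<bar> \<le> \<eta> * (b - a) + e * (b - a)"
    by (simp add: P_def algebra_simps)
  also have "e * (b - a) \<le> e0" using e0 ab by (simp add: e_def field_simps)
  finally show "\<bar>g b - g a - c * (b - a)\<bar> \<le> \<eta> * (b - a) + e0" by simp
qed

section \<open>Partitions of an interval by points of the time scale\<close>

definition ts_partition :: "real set \<Rightarrow> real \<Rightarrow> real \<Rightarrow> real \<Rightarrow> nat \<Rightarrow> (nat \<Rightarrow> real) \<Rightarrow> bool" where
  "ts_partition T \<delta> a b m r \<longleftrightarrow> r 0 = a \<and> r m = b \<and>
     (\<forall>k<m. r k < r (Suc k) \<and> (r (Suc k) - r k \<le> \<delta> \<or> {r k<..<r (Suc k)} \<inter> T = {})) \<and>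
     (\<forall>k\<le>m. r k \<in> T)"

lemma ts_partition_refl: "a \<in> T \<Longrightarrow> ts_partition T \<delta> a a 0 (\<lambda>_. a)"
  by (auto simp: ts_partition_def)

lemma ts_partition_Cons:
  assumes "ts_partition T \<delta> c b m r" "a \<in> T" "a < c" "c - a \<le> \<delta> \<or> {a<..<c} \<inter> T = {}"
  shows "ts_partition T \<delta> a b (Suc m) (case_nat a r)"
proof -
  let ?r = "case_nat a r"
  have "?r k < ?r (Suc k) \<and> (?r (Suc k) - ?r k \<le> \<delta> \<or> {?r k<..<?r (Suc k)} \<inter> T = {})" if "k < Suc m" for k
    using assms that by (cases k) (simp_all add: ts_partition_def)
  moreover have "?r k \<in> T" if "k \<le> Suc m" for k
    using assms that by (cases k) (simp_all add: ts_partition_def)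
  ultimately show ?thesis using assms by (simp add: ts_partition_def)
qed

text \<open>Each round advances by at least \<delta>: from \<open>a\<close> to the last point
  \<open>c\<close> of \<open>T\<close> not beyond \<open>a + \<delta>\<close>, then across a
  possible gap to the first point \<open>d\<close> not before \<open>a + \<delta>\<close>. The
  induction runs on the number \<open>N\<close> of lengths \<delta> that cover the distance to
  \<open>b\<close>.\<close>

lemma ts_partition_exists:
  assumes T: "closed T" and "\<delta> > 0" "a \<in> T" "b \<in> T" "a \<le> b"
  shows "\<exists>m r. ts_partition T \<delta> a b m r"
proof -
  have "\<exists>m r. ts_partition T \<delta> a b m r"
    if "a \<in> T" "a \<le> b" "b - a \<le> real N * \<delta>" for N a
    using that
  proof (induction N arbitrary: a)
    case 0
    hence "a = b" by simp
    thus ?case using ts_partition_refl[of a T \<delta>] 0 by blast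
  next
    case (Suc N)
    have cons: "\<exists>m r. ts_partition T \<delta> u b m r"
      if ex: "\<exists>m r. ts_partition T \<delta> v b m r" and "u \<in> T" "u \<le> v" "v - u \<le> \<delta> \<or> {u<..<v} \<inter> T = {}" for u v
    proof (cases "u = v")
      case False
      obtain m r where "ts_partition T \<delta> v b m r" using ex by blast
      hence "ts_partition T \<delta> u b (Suc m) (case_nat u r)"
        using that False by (intro ts_partition_Cons) auto
      thus ?thesis by blast
    qed (use that in simp)
    show ?case
    proof (cases "b - a \<le> \<delta>")
      case True
      have "\<exists>m r. ts_partition T \<delta> b b m r" using ts_partition_refl assms by blast
      thus ?thesis by (rule cons) (use Suc True in auto)
    next
      case False
      let ?C = "T \<inter> {a..a+\<delta>}" and ?D = "T \<inter> {a+\<delta>..b}"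
      define c d where "c = Sup ?C" and "d = Inf ?D"
      have C: "?C \<noteq> {}" "bdd_above ?C" using Suc \<open>\<delta> > 0\<close> by auto
      have D: "?D \<noteq> {}" "bdd_below ?D" using False assms by auto
      have "c \<in> ?C" unfolding c_def by (rule closed_contains_Sup[OF C]) (use T in auto)
      moreover have "d \<in> ?D" unfolding d_def by (rule closed_contains_Inf[OF D]) (use T in auto)
      ultimately have cd: "c \<in> T" "a \<le> c" "c \<le> a + \<delta>" "d \<in> T" "a + \<delta> \<le> d" "d \<le> b" by auto
      have "{c<..<d} \<inter> T = {}"
      proof (rule ccontr)
        assume "{c<..<d} \<inter> T \<noteq> {}"
        then obtain u where u: "u \<in> T" "c < u" "u < d" by auto
        show False
        proof (cases "u \<le> a + \<delta>")
          case True
          hence "u \<le> c" unfolding c_def using u cd by (intro cSup_upper C) auto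
          thus False using u by simp
        next
          case False
          hence "d \<le> u" unfolding d_def using u cd by (intro cInf_lower D) auto
          thus False using u by simp
        qed
      qed
      moreover have "\<exists>m r. ts_partition T \<delta> d b m r"
        using Suc cd by (intro Suc.IH) (auto simp: algebra_simps)
      ultimately have "\<exists>m r. ts_partition T \<delta> c b m r" using cd by (intro cons[of d c]) auto
      thus ?thesis using cd Suc by (intro cons[of c a]) auto
    qed
  qed
  moreover obtain N where "b - a < real N * \<delta>" using reals_Archimedean3[OF \<open>\<delta> > 0\<close>] by blast
  ultimately show ?thesis using assms by (meson less_imp_le)
qed

lemma ts_partition_mono:
  assumes "ts_partition T \<delta> a b m r" "i \<le> j" "j \<le> m"
  shows "r i \<le> r j"
  using assms(2,3)
proof (induction j rule: dec_induct)
  case (step n)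
  have "r n < r (Suc n)" using assms(1) step by (auto simp: ts_partition_def)
  thus ?case using step by simp
qed simp

lemma ts_partition_range:
  assumes "ts_partition T \<delta> a b m r" "k \<le> m"
  shows "r k \<in> T" "a \<le> r k" "r k \<le> b"
  using assms ts_partition_mono[OF assms(1), of 0 k] ts_partition_mono[OF assms(1), of k m]
  by (auto simp: ts_partition_def)

lemma ts_partition_step:
  assumes "ts_partition T \<delta> a b m r" "k < m"
  shows "r k < r (Suc k)" "r (Suc k) - r k \<le> \<delta> \<or> {r k<..<r (Suc k)} \<inter> T = {}"
  using assms by (auto simp: ts_partition_def)

lemma ts_partition_find:
  assumes "ts_partition T \<delta> a b m r" "a \<le> s" "s < b"
  obtains k where "k < m" "r k \<le> s" "s < r (Suc k)"
proof -
  have ex: "\<exists>k. k \<le> m \<and> s < r k" using assms by (auto simp: ts_partition_def)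
  define k where "k = (LEAST k. k \<le> m \<and> s < r k)"
  have k: "k \<le> m" "s < r k" using LeastI_ex[OF ex] by (auto simp: k_def)
  have "k \<noteq> 0" using k assms by (metis ts_partition_def not_less)
  then obtain j where j: "k = Suc j" by (cases k) auto
  have "\<not> (j \<le> m \<and> s < r j)" using not_less_Least[of j "\<lambda>k. k \<le> m \<and> s < r k"] j by (auto simp: k_def)
  thus ?thesis using that[of j] k j by auto
qed

lemma ts_partition_inj:
  assumes "ts_partition T \<delta> a b m r" "i < m" "j < m" "r i \<le> s" "s < r (Suc i)" "r j \<le> s" "s < r (Suc j)"
  shows "i = j"
proof (rule ccontr)
  assume "i \<noteq> j"
  then consider "Suc i \<le> j" | "Suc j \<le> i" by linarith
  thus False
    using ts_partition_mono[OF assms(1), of "Suc i" j] ts_partition_mono[OF assms(1), of "Suc j" i] assms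
    by cases auto
qed

lemma ts_partition_sum_lengths:
  assumes "ts_partition T \<delta> a b m r"
  shows "(\<Sum>k<m. r (Suc k) - r k) = b - a"
  using sum_lessThan_telescope[of r m] assms by (simp add: ts_partition_def)

lemma simple_proc_eq:
  assumes "ts_partition T \<delta> a b m r" "k < m" "r k \<le> s" "s < r (Suc k)"
  shows "simple_proc m r xi s w = xi k w"
proof -
  have "simple_proc m r xi s w = (\<Sum>j<m. if j = k then xi k w else 0)"
    unfolding simple_proc_def
  proof (rule sum.cong)
    fix j assume j: "j \<in> {..<m}"
    show "indicator {r j..<r (Suc j)} s * xi j w = (if j = k then xi k w else 0)"
    proof (cases "j = k")
      case False
      hence "s \<notin> {r j..<r (Suc j)}" using ts_partition_inj[OF assms(1) _ assms(2) _ _ assms(3,4)] j by auto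
      thus ?thesis using False by simp
    qed (use assms in simp)
  qed simp
  thus ?thesis using assms by simp
qed

lemma simple_adaptedI:
  assumes "ts_partition T \<delta> a b m r" "\<And>k. k < m \<Longrightarrow> xi k \<in> borel_measurable (F (r k))"
  shows "simple_adapted F a b m r xi"
  using assms by (auto simp: simple_adapted_def ts_partition_def)

section \<open>Gaps and Riemann sums\<close>

text \<open>Every gap other than the one with the largest left endpoint \<open>a\<close> ends at or
  before \<open>a\<close>, so it is a gap of \<open>[t1, a]\<close>. The right end of the interval
  therefore varies in the induction.\<close>

lemma sum_gap_lengths_le:
  assumes T: "closed T" and "finite G" "G \<subseteq> ts_gaps_in T t1 t2" "t2 \<in> T" "t1 \<le> t2"
  shows "(\<Sum>a\<in>G. ts_sigma T a - a) \<le> t2 - t1"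
  using assms(2-)
proof (induction G arbitrary: t2 rule: finite_linorder_max_induct)
  case (insert a G)
  have a: "a \<in> T" "t1 \<le> a" "ts_sigma T a \<le> t2" "a < ts_sigma T a"
    using insert.prems by (auto simp: ts_gaps_in_def)
  have "G \<subseteq> ts_gaps_in T t1 a"
  proof
    fix x assume x: "x \<in> G"
    hence "x \<in> ts_gaps_in T t1 t2" "x < a" using insert by auto
    thus "x \<in> ts_gaps_in T t1 a" using ts_sigma_props(3)[OF T _ a(1)] by (auto simp: ts_gaps_in_def)
  qed
  hence "(\<Sum>a\<in>G. ts_sigma T a - a) \<le> a - t1" using a by (intro insert.IH) auto
  moreover have "a \<notin> G" using insert by auto
  ultimately show ?case using insert a by simp
qed simp

lemma finite_long_gaps:
  assumes T: "closed T" and d: "\<delta> > 0" and "t2 \<in> T" "t1 \<le> t2"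
  shows "finite {a \<in> ts_gaps_in T t1 t2. ts_sigma T a - a > \<delta>}"
proof (rule finite_if_finite_subsets_card_bdd[THEN conjunct1])
  fix G assume G: "G \<subseteq> {a \<in> ts_gaps_in T t1 t2. ts_sigma T a - a > \<delta>}" "finite G"
  have "real (card G) * \<delta> = (\<Sum>a\<in>G. \<delta>)" by simp
  also have "\<dots> \<le> (\<Sum>a\<in>G. ts_sigma T a - a)" using G by (intro sum_mono) auto
  also have "\<dots> \<le> t2 - t1" using G by (intro sum_gap_lengths_le assms) auto
  finally have "real (card G) \<le> (t2 - t1) / \<delta>" using d by (simp add: field_simps)
  thus "card G \<le> nat \<lfloor>(t2 - t1) / \<delta>\<rfloor>" by (simp add: le_nat_floor)
qed

text \<open>A step longer than \<delta> has no point of \<open>T\<close> inside and so is a gap.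
  Conversely no partition point falls inside a gap, so a long gap lies within one step; this step is
  long too, has no point of \<open>T\<close> inside, and hence starts at the left end of the
  gap.\<close>

lemma ts_partition_long_steps:
  assumes T: "closed T" and p: "ts_partition T \<delta> t1 t2 m r"
  shows "\<And>k. k < m \<Longrightarrow> r (Suc k) - r k > \<delta> \<Longrightarrow> ts_sigma T (r k) = r (Suc k)"
    and "bij_betw r {k. k < m \<and> r (Suc k) - r k > \<delta>} {a \<in> ts_gaps_in T t1 t2. ts_sigma T a - a > \<delta>}"
proof -
  show sg: "ts_sigma T (r k) = r (Suc k)" if k: "k < m" "r (Suc k) - r k > \<delta>" for k
    using ts_partition_step[OF p k(1)] ts_partition_range(1)[OF p, of k]
      ts_partition_range(1)[OF p, of "Suc k"] k
    by (intro ts_sigma_eqI T) auto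
  show "bij_betw r {k. k < m \<and> r (Suc k) - r k > \<delta>} {a \<in> ts_gaps_in T t1 t2. ts_sigma T a - a > \<delta>}"
    unfolding bij_betw_def
  proof (intro conjI equalityI subsetI)
    show "inj_on r {k. k < m \<and> r (Suc k) - r k > \<delta>}"
    proof (rule inj_onI)
      fix i j assume "i \<in> {k. k < m \<and> r (Suc k) - r k > \<delta>}" "j \<in> {k. k < m \<and> r (Suc k) - r k > \<delta>}" "r i = r j"
      thus "i = j" using ts_partition_step(1)[OF p, of i] ts_partition_step(1)[OF p, of j]
        by (intro ts_partition_inj[OF p, of i j "r i"]) auto
    qed
  next
    fix a assume "a \<in> r ` {k. k < m \<and> r (Suc k) - r k > \<delta>}"
    then obtain k where k: "k < m" "r (Suc k) - r k > \<delta>" "a = r k" by auto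
    thus "a \<in> {a \<in> ts_gaps_in T t1 t2. ts_sigma T a - a > \<delta>}"
      using sg[of k] ts_partition_range[OF p, of k] ts_partition_range[OF p, of "Suc k"]
        ts_partition_step(1)[OF p, of k]
      by (simp add: ts_gaps_in_def)
  next
    fix a assume "a \<in> {a \<in> ts_gaps_in T t1 t2. ts_sigma T a - a > \<delta>}"
    hence a: "a \<in> T" "t1 \<le> a" "a < ts_sigma T a" "ts_sigma T a \<le> t2" "ts_sigma T a - a > \<delta>"
      by (auto simp: ts_gaps_in_def)
    obtain k where k: "k < m" "r k \<le> a" "a < r (Suc k)"
      using ts_partition_find[OF p, of a] a by auto
    have T': "r (Suc k) \<in> T" using ts_partition_range(1)[OF p, of "Suc k"] k by simp
    have "ts_sigma T a \<le> r (Suc k)" by (rule ts_sigma_props(3)[OF T a(1) T' k(3)])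
    hence len: "r (Suc k) - r k > \<delta>" using a k by simp
    hence "{r k<..<r (Suc k)} \<inter> T = {}" using ts_partition_step(2)[OF p k(1)] by auto
    hence "a = r k" using k a by force
    thus "a \<in> r ` {k. k < m \<and> r (Suc k) - r k > \<delta>}" using k len by auto
  qed
qed

section \<open>Taylor's formula and uniform bounds on compact sets\<close>

text \<open>The intermediate point is located in two ways: its distance to \<open>x\<close> serves
  the estimates by uniform continuity, the interval between \<open>x\<close> and \<open>y\<close>
  those by boundedness.\<close>

lemma taylor2:
  fixes g g' g'' :: "real \<Rightarrow> real"
  assumes "\<And>x. (g has_real_derivative g' x) (at x)" "\<And>x. (g' has_real_derivative g'' x) (at x)"
  obtains \<xi> where "\<bar>\<xi> - x\<bar> \<le> \<bar>y - x\<bar>" "\<xi> \<in> {min x y..max x y}"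
    "g y = g x + g' x * (y - x) + 1/2 * g'' \<xi> * (y - x)\<^sup>2"
proof (cases "x = y")
  case True
  thus ?thesis using that[of x] by simp
next
  case False
  let ?d = "\<lambda>n::nat. if n = 0 then g else if n = 1 then g' else g''"
  have "\<exists>t. (if y < x then y < t \<and> t < x else x < t \<and> t < y) \<and>
      g y = (\<Sum>i<2. ?d i x / fact i * (y - x) ^ i) + ?d 2 t / fact 2 * (y - x) ^ 2"
    by (rule Taylor[of 2 ?d g "min x y" "max x y" x y]) (use assms False in \<open>auto simp: less_2_cases_iff\<close>)
  then obtain t where t: "if y < x then y < t \<and> t < x else x < t \<and> t < y"
      "g y = (\<Sum>i<2. ?d i x / fact i * (y - x) ^ i) + ?d 2 t / fact 2 * (y - x) ^ 2" by blast
  show ?thesis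
    by (rule that[of t]) (use t in \<open>auto simp: numeral_2_eq_2 split: if_splits\<close>)
qed

lemma uniformly_continuous_strip:
  fixes h :: "real \<Rightarrow> real \<Rightarrow> real"
  assumes "closed A" "continuous_on (A \<times> UNIV) (\<lambda>(t, x). h t x)" "\<eta> > 0"
  obtains d where "d > 0"
    "\<And>t t' x x'. \<lbrakk>t \<in> A; t' \<in> A; a \<le> t; t \<le> b; a \<le> t'; t' \<le> b; \<bar>x\<bar> \<le> K; \<bar>x'\<bar> \<le> K; \<bar>t - t'\<bar> < d; \<bar>x - x'\<bar> < d\<rbrakk>
        \<Longrightarrow> \<bar>h t x - h t' x'\<bar> < \<eta>"
proof -
  let ?C = "(A \<inter> {a..b}) \<times> {-K..K}"
  have "compact ?C" using assms by (intro compact_Times closed_Int_compact) auto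
  moreover have "continuous_on ?C (\<lambda>(t, x). h t x)" by (rule continuous_on_subset[OF assms(2)]) auto
  ultimately have "uniformly_continuous_on ?C (\<lambda>(t, x). h t x)" by (rule compact_uniformly_continuous[rotated])
  then obtain d where d: "d > 0"
    "\<And>p q. p \<in> ?C \<Longrightarrow> q \<in> ?C \<Longrightarrow> dist q p < d \<Longrightarrow> dist ((\<lambda>(t, x). h t x) q) ((\<lambda>(t, x). h t x) p) < \<eta>"
    using \<open>\<eta> > 0\<close> unfolding uniformly_continuous_on_def by metis
  \<comment> \<open>The distance of pairs is at most the sum of the coordinate distances, hence half
    of \<open>d\<close> for each.\<close>
  show ?thesis
  proof (rule that[of "d / 2"])
    fix t t' x x' assume *: "t \<in> A" "t' \<in> A" "a \<le> t" "t \<le> b" "a \<le> t'" "t' \<le> b" "\<bar>x\<bar> \<le> K" "\<bar>x'\<bar> \<le> K"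
      "\<bar>t - t'\<bar> < d / 2" "\<bar>x - x'\<bar> < d / 2"
    have "dist (t, x) (t', x') \<le> \<bar>t - t'\<bar> + \<bar>x - x'\<bar>"
      unfolding dist_Pair_Pair dist_real_def using sqrt_sum_squares_le_sum_abs by simp
    hence "dist (t, x) (t', x') < d" using * by simp
    thus "\<bar>h t x - h t' x'\<bar> < \<eta>" using d(2)[of "(t', x')" "(t, x)"] * by (simp add: dist_real_def abs_le_iff)
  qed (use d in simp)
qed

lemma bounded_strip:
  fixes h :: "real \<Rightarrow> real \<Rightarrow> real"
  assumes "closed A" "continuous_on (A \<times> UNIV) (\<lambda>(t, x). h t x)"
  obtains C where "C \<ge> 0" "\<And>t x. \<lbrakk>t \<in> A; a \<le> t; t \<le> b; \<bar>x\<bar> \<le> K\<rbrakk> \<Longrightarrow> \<bar>h t x\<bar> \<le> C"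
proof -
  let ?C = "(A \<inter> {a..b}) \<times> {-K..K}"
  have "compact ?C" using assms by (intro compact_Times closed_Int_compact) auto
  moreover have "continuous_on ?C (\<lambda>(t, x). h t x)" by (rule continuous_on_subset[OF assms(2)]) auto
  ultimately have "bounded ((\<lambda>(t, x). h t x) ` ?C)" by (intro compact_imp_bounded compact_continuous_image)
  then obtain C where C: "C > 0" "\<And>y. y \<in> (\<lambda>(t, x). h t x) ` ?C \<Longrightarrow> norm y \<le> C"
    unfolding bounded_pos by blast
  show ?thesis
  proof (rule that[of C])
    fix t x assume "t \<in> A" "a \<le> t" "t \<le> b" "\<bar>x\<bar> \<le> K"
    thus "\<bar>h t x\<bar> \<le> C" using C(2)[of "h t x"] by (force simp: abs_le_iff)
  qed (use C in simp)
qed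

lemma bounded_path:
  fixes b :: "real \<Rightarrow> real"
  assumes "continuous_on {t1..t2} b"
  obtains K where "K > 0" "\<And>t. t1 \<le> t \<Longrightarrow> t \<le> t2 \<Longrightarrow> \<bar>b t\<bar> \<le> K"
proof -
  have "bounded (b ` {t1..t2})" using assms by (intro compact_imp_bounded compact_continuous_image) auto
  then obtain K where "K > 0" "\<And>y. y \<in> b ` {t1..t2} \<Longrightarrow> norm y \<le> K" unfolding bounded_pos by blast
  thus ?thesis using that[of K] by auto
qed

lemma uniformly_continuous_path:
  fixes b :: "real \<Rightarrow> real"
  assumes "continuous_on {t1..t2} b" "\<eta> > 0"
  obtains d where "d > 0" "\<And>t t'. \<lbrakk>t1 \<le> t; t \<le> t2; t1 \<le> t'; t' \<le> t2; \<bar>t - t'\<bar> < d\<rbrakk> \<Longrightarrow> \<bar>b t - b t'\<bar> < \<eta>"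
proof -
  have "uniformly_continuous_on {t1..t2} b" using assms by (intro compact_uniformly_continuous) auto
  then obtain d where "d > 0" "\<And>t t'. t \<in> {t1..t2} \<Longrightarrow> t' \<in> {t1..t2} \<Longrightarrow> dist t' t < d \<Longrightarrow> dist (b t') (b t) < \<eta>"
    using assms(2) unfolding uniformly_continuous_on_def by metis
  thus ?thesis using that[of d] by (auto simp: dist_real_def)
qed

section \<open>Riemann sums along a sequence of partitions\<close>

locale ts_partition_seq =
  fixes T :: "real set" and t1 t2 :: real and \<delta> :: "nat \<Rightarrow> real" and m :: "nat \<Rightarrow> nat" and r :: "nat \<Rightarrow> nat \<Rightarrow> real"
  assumes T: "closed T" and t1T: "t1 \<in> T" and t2T: "t2 \<in> T" and t1_nonneg: "0 \<le> t1" and t12: "t1 \<le> t2"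
    and \<delta>_pos: "\<And>n. \<delta> n > 0" and \<delta>_lim: "\<delta> \<longlonglongrightarrow> 0"
    and part: "\<And>n. ts_partition T (\<delta> n) t1 t2 (m n) (r n)"
begin

abbreviation "gaps \<equiv> ts_gaps_in T t1 t2"
abbreviation "\<sigma> \<equiv> ts_sigma T"
abbreviation "ext \<equiv> ts_ext T"
text \<open>A gap of length at most \<open>\<delta> n\<close> counts as small; it becomes a long gap
  only at later stages.\<close>

definition "small n k \<longleftrightarrow> r n (Suc k) - r n k \<le> \<delta> n"
definition "long_gaps n = {a \<in> gaps. \<sigma> a - a > \<delta> n}"

lemmas part_range = ts_partition_range[OF part]
lemmas part_step = ts_partition_step[OF part]

lemma part_in:
  assumes "k < m n"
  shows "r n k \<in> T" "t1 \<le> r n k" "r n k < t2" "r n (Suc k) \<in> T" "t1 \<le> r n (Suc k)" "r n (Suc k) \<le> t2"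
    "r n k < r n (Suc k)" "0 \<le> r n k" "r n k \<in> ts_kappa T"
proof -
  show *: "r n k \<in> T" "t1 \<le> r n k" "r n (Suc k) \<in> T" "t1 \<le> r n (Suc k)" "r n (Suc k) \<le> t2" "r n k < r n (Suc k)"
    using part_range[of k n] part_range[of "Suc k" n] part_step[of k n] assms by auto
  show "r n k < t2" "0 \<le> r n k" using * t1_nonneg by auto
  show "r n k \<in> ts_kappa T" by (rule ts_kappaI[OF *(1,3,6)])
qed

lemma finite_long_gaps': "finite (long_gaps n)"
  unfolding long_gaps_def by (rule finite_long_gaps[OF T \<delta>_pos t2T t12])

lemma sigma_not_small: "k < m n \<Longrightarrow> \<not> small n k \<Longrightarrow> \<sigma> (r n k) = r n (Suc k)"
  using ts_partition_long_steps(1)[OF T part] by (auto simp: small_def)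

text \<open>Spreading the sum over all steps of the partition lets it be added to the other sums
  term by term.\<close>

lemma sum_long_gaps: "(\<Sum>a\<in>long_gaps n. h a) = (\<Sum>k<m n. if small n k then 0 else h (r n k))"
proof -
  have "(\<Sum>a\<in>long_gaps n. h a) = (\<Sum>k\<in>{k. k < m n \<and> r n (Suc k) - r n k > \<delta> n}. h (r n k))"
    unfolding long_gaps_def by (rule sum.reindex_bij_betw[OF ts_partition_long_steps(2)[OF T part], symmetric])
  also have "\<dots> = (\<Sum>k\<in>{..<m n} \<inter> {k. \<not> small n k}. h (r n k))"
    by (rule sum.cong) (auto simp: small_def)
  also have "\<dots> = (\<Sum>k<m n. if small n k then 0 else h (r n k))"
    by (subst sum.inter_restrict) (auto intro!: sum.cong)
  finally show ?thesis .
qed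

lemma eventually_\<delta>_less: "d > 0 \<Longrightarrow> \<forall>\<^sub>F n in sequentially. \<delta> n < d"
  using order_tendstoD(2)[OF \<delta>_lim] .

lemma gap_eventually_long: "a \<in> gaps \<Longrightarrow> \<forall>\<^sub>F n in sequentially. a \<in> long_gaps n"
  using eventually_\<delta>_less[of "\<sigma> a - a"] by (auto simp: long_gaps_def ts_gaps_in_def)

lemma finite_gaps_eventually_long:
  assumes "finite G" "G \<subseteq> gaps"
  shows "\<forall>\<^sub>F n in sequentially. G \<subseteq> long_gaps n"
proof -
  have "\<forall>\<^sub>F n in sequentially. \<forall>a\<in>G. a \<in> long_gaps n"
    using gap_eventually_long assms by (intro eventually_ball_finite) auto
  thus ?thesis by (simp add: subset_eq)
qed

text \<open>\<open>has_sum\<close> means convergence along the finite subsets of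
  \<open>gaps\<close>. As \<open>\<delta>\<close> tends to 0, the finite sets
  \<open>long_gaps n\<close> eventually contain any given one, so they follow that filter.\<close>

lemma sum_long_gaps_tendsto:
  fixes h :: "real \<Rightarrow> real"
  assumes "(h has_sum s) gaps"
  shows "(\<lambda>n. \<Sum>a\<in>long_gaps n. h a) \<longlonglongrightarrow> s"
proof -
  have "filterlim long_gaps (finite_subsets_at_top gaps) sequentially"
    unfolding filterlim_finite_subsets_at_top
  proof (intro allI impI)
    fix X assume "finite X \<and> X \<subseteq> gaps"
    hence "\<forall>\<^sub>F n in sequentially. X \<subseteq> long_gaps n" using finite_gaps_eventually_long by blast
    thus "\<forall>\<^sub>F n in sequentially. finite (long_gaps n) \<and> X \<subseteq> long_gaps n \<and> long_gaps n \<subseteq> gaps"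
      using finite_long_gaps' by (auto simp: long_gaps_def elim: eventually_mono)
  qed
  with assms show ?thesis unfolding has_sum_def by (rule filterlim_compose)
qed

lemma sum_steps: "(\<Sum>k<m n. c * (r n (Suc k) - r n k)) = c * (t2 - t1)"
  using ts_partition_sum_lengths[OF part, of n] by (simp add: sum_distrib_left[symmetric])

text \<open>The approximation is uniform in spite of long steps: within one of them
  \<open>ext s\<close> can only be the left endpoint, so the step function is exact.
  \<open>A\<close> is asked to contain only the points before \<open>t2\<close>, because
  \<open>t2\<close> may be missing from \<open>ts_kappa T\<close>, the domain of
  \<open>fd\<close>.\<close>

lemma step_approx:
  fixes u :: "real \<Rightarrow> real"
  assumes "compact A" "continuous_on A u" "T \<inter> {t1..<t2} \<subseteq> A" "\<eta> > 0"
  shows "\<forall>\<^sub>F n in sequentially. \<forall>s\<in>{t1..<t2}. \<bar>simple_proc (m n) (r n) (\<lambda>k _. u (r n k)) s w - u (ext s)\<bar> \<le> \<eta>"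
proof -
  have "uniformly_continuous_on A u" by (rule compact_uniformly_continuous[OF assms(2,1)])
  then obtain d where d: "d > 0" "\<And>t t'. t \<in> A \<Longrightarrow> t' \<in> A \<Longrightarrow> dist t' t < d \<Longrightarrow> dist (u t') (u t) < \<eta>"
    using assms(4) unfolding uniformly_continuous_on_def by metis
  show ?thesis using eventually_\<delta>_less[OF d(1)]
  proof eventually_elim
    case (elim n)
    show ?case
    proof
      fix s assume s: "s \<in> {t1..<t2}"
      obtain k where k: "k < m n" "r n k \<le> s" "s < r n (Suc k)" using ts_partition_find[OF part, of s] s by auto
      note e = ts_ext_props[OF T t1T t1_nonneg, of s]
      have re: "r n k \<le> ext s" by (rule e(4)) (use part_in[OF k(1)] k s in auto)
      have "\<bar>u (r n k) - u (ext s)\<bar> \<le> \<eta>"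
      proof (cases "ext s = r n k")
        case False
        hence "ext s \<in> {r n k<..<r n (Suc k)} \<inter> T" using re e k s by auto
        hence "r n (Suc k) - r n k \<le> \<delta> n" using part_step(2)[OF k(1)] by blast
        hence "dist (r n k) (ext s) < d" using re e k s elim by (auto simp: dist_real_def)
        moreover have "r n k \<in> A" "ext s \<in> A" using part_in[OF k(1)] e s assms(3) by auto
        ultimately show ?thesis using d(2)[of "ext s" "r n k"] by (simp add: dist_real_def)
      qed (use assms in simp)
      thus "\<bar>simple_proc (m n) (r n) (\<lambda>k _. u (r n k)) s w - u (ext s)\<bar> \<le> \<eta>"
        by (simp add: simple_proc_eq[OF part k])
    qed
  qed
qed

text \<open>Since \<open>ext\<close> need not be continuous, measurability comes from a pointwise
  limit of step functions; boundedness of \<open>u\<close> on the compact \<open>A\<close> does the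
  rest.\<close>

lemma ext_integrable:
  fixes u :: "real \<Rightarrow> real"
  assumes "compact A" "continuous_on A u" "T \<inter> {t1..<t2} \<subseteq> A"
  shows "integrable lborel (\<lambda>s. indicator {t1..<t2} s * u (ext s))"
proof -
  \<comment> \<open>The simple process is deterministic here; \<open>()\<close> fills the place of
    the sample point.\<close>
  let ?f = "\<lambda>n s. indicator {t1..<t2} s * simple_proc (m n) (r n) (\<lambda>k _. u (r n k)) s ()"
  have "(\<lambda>n. ?f n s) \<longlonglongrightarrow> indicator {t1..<t2} s * u (ext s)" for s
  proof (cases "s \<in> {t1..<t2}")
    case True
    have "(\<lambda>n. simple_proc (m n) (r n) (\<lambda>k _. u (r n k)) s ()) \<longlonglongrightarrow> u (ext s)"
    proof (rule LIMSEQ_I)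
      fix e :: real assume "e > 0"
      hence "\<forall>\<^sub>F n in sequentially. \<bar>simple_proc (m n) (r n) (\<lambda>k _. u (r n k)) s () - u (ext s)\<bar> \<le> e / 2"
        using step_approx[OF assms, of "e / 2" "()"] True by (auto elim: eventually_mono)
      then obtain N where "\<And>n. n \<ge> N \<Longrightarrow> \<bar>simple_proc (m n) (r n) (\<lambda>k _. u (r n k)) s () - u (ext s)\<bar> \<le> e / 2"
        unfolding eventually_sequentially by blast
      thus "\<exists>N. \<forall>n\<ge>N. norm (simple_proc (m n) (r n) (\<lambda>k _. u (r n k)) s () - u (ext s)) < e"
        using \<open>e > 0\<close> by (intro exI[of _ N]) force
    qed
    thus ?thesis using True by simp
  qed simp
  hence meas: "(\<lambda>s. indicator {t1..<t2} s * u (ext s)) \<in> borel_measurable lborel"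
    by (rule borel_measurable_LIMSEQ_real) (unfold simple_proc_def, measurable)
  obtain C where C: "C > 0" "\<And>y. y \<in> u ` A \<Longrightarrow> norm y \<le> C"
    using compact_imp_bounded[OF compact_continuous_image[OF assms(2,1)]] unfolding bounded_pos by blast
  have "\<bar>indicator {t1..<t2} s * u (ext s)\<bar> \<le> indicator {t1..<t2} s * C" for s
  proof (cases "s \<in> {t1..<t2}")
    case True
    hence "ext s \<in> A" using ts_ext_props[OF T t1T t1_nonneg, of s] assms(3) by auto
    thus ?thesis using True C(2)[of "u (ext s)"] by simp
  qed simp
  hence bnd: "AE s in lborel. norm (indicator {t1..<t2} s * u (ext s)) \<le> norm (indicator {t1..<t2} s * C)"
    using C(1) by (intro AE_I2) (simp add: abs_mult)
  have "integrable lborel (\<lambda>s. indicator {t1..<t2} s * C)"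
    by (intro integrable_mult_left integrable_real_indicator) (use t12 in auto)
  thus ?thesis by (rule Bochner_Integration.integrable_bound[OF _ meas bnd])
qed

text \<open>The value of \<open>u\<close> at \<open>t2\<close> is not controlled by
  \<open>A\<close>, but a single point has measure 0.\<close>

lemma LBINT_ext_eq:
  fixes u :: "real \<Rightarrow> real"
  assumes "compact A" "continuous_on A u" "T \<inter> {t1..<t2} \<subseteq> A"
  shows "(LBINT s:{t1..t2}. u (ext s)) = (LBINT s. indicator {t1..<t2} s * u (ext s))"
proof -
  have eq: "indicator {t1..t2} s * u (ext s) = indicator {t1..<t2} s * u (ext s) + indicator {t2} s * u (ext t2)" for s
    using t12 by (auto simp: indicator_def)
  have int: "integrable lborel (\<lambda>s. indicator {t2} s * u (ext t2))" by simp
  have "(LBINT s:{t1..t2}. u (ext s)) = (LBINT s. indicator {t1..<t2} s * u (ext s)) + (LBINT s. indicator {t2} s * u (ext t2))"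
    unfolding set_lebesgue_integral_def real_scaleR_def eq
    by (rule Bochner_Integration.integral_add[OF ext_integrable[OF assms] int])
  thus ?thesis by simp
qed

text \<open>The sum is the integral of the step function with values \<open>u (r n k)\<close>, which
  is uniformly close to the extended integrand.\<close>

lemma riemann_tendsto:
  fixes u :: "real \<Rightarrow> real"
  assumes "compact A" "continuous_on A u" "T \<inter> {t1..<t2} \<subseteq> A"
  shows "(\<lambda>n. \<Sum>k<m n. u (r n k) * (r n (Suc k) - r n k)) \<longlonglongrightarrow> (LBINT s:{t1..t2}. u (ext s))"
proof (rule LIMSEQ_I)
  fix e :: real assume e: "e > 0"
  define \<eta> where "\<eta> = e / (2 * (t2 - t1 + 1))"
  have \<eta>: "\<eta> > 0" using e t12 by (simp add: \<eta>_def)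
  obtain N where N: "\<And>n s. n \<ge> N \<Longrightarrow> s \<in> {t1..<t2} \<Longrightarrow>
      \<bar>simple_proc (m n) (r n) (\<lambda>k _. u (r n k)) s () - u (ext s)\<bar> \<le> \<eta>"
    using step_approx[OF assms \<eta>, of "()"] unfolding eventually_sequentially by blast
  have "norm ((\<Sum>k<m n. u (r n k) * (r n (Suc k) - r n k)) - (LBINT s:{t1..t2}. u (ext s))) < e" if n: "n \<ge> N" for n
  proof -
    let ?p = "\<lambda>s. simple_proc (m n) (r n) (\<lambda>k _. u (r n k)) s ()"
    let ?v = "\<lambda>s. indicator {t1..<t2} s * u (ext s)"
    have ip: "integrable lborel ?p"
      unfolding simple_proc_def by (intro Bochner_Integration.integrable_sum integrable_mult_left integrable_real_indicator) (use part_in(7) in \<open>auto simp: less_imp_le\<close>)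
    have "(LBINT s. ?p s) = (\<Sum>k<m n. u (r n k) * (r n (Suc k) - r n k))"
      unfolding simple_proc_def using part_in by (subst Bochner_Integration.integral_sum) (auto intro!: sum.cong simp: less_imp_le)
    hence "(\<Sum>k<m n. u (r n k) * (r n (Suc k) - r n k)) - (LBINT s:{t1..t2}. u (ext s)) = (LBINT s. ?p s - ?v s)"
      using LBINT_ext_eq[OF assms] ip ext_integrable[OF assms] by (simp add: Bochner_Integration.integral_diff)
    also have "norm \<dots> \<le> (LBINT s. norm (?p s - ?v s))" by (rule integral_norm_bound)
    also have "\<dots> \<le> (LBINT s. indicator {t1..<t2} s * \<eta>)"
    proof (rule integral_mono')
      fix s
      show "norm (?p s - ?v s) \<le> indicator {t1..<t2} s * \<eta>"
      proof (cases "s \<in> {t1..<t2}")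
        case False
        have "s \<notin> {r n k..<r n (Suc k)}" if "k < m n" for k using part_in[OF that] False by auto
        hence "?p s = 0" unfolding simple_proc_def by (intro sum.neutral) auto
        thus ?thesis using False by simp
      qed (use N[OF n] in simp)
    qed (use \<eta> t12 in \<open>auto intro!: integrable_mult_left integrable_real_indicator\<close>)
    also have "\<dots> = \<eta> * (t2 - t1)" using t12 by simp
    also have "\<dots> < e"
    proof -
      have "e * (t2 - t1) < e * (2 * (t2 - t1 + 1))" using e t12 by (intro mult_strict_left_mono) auto
      thus ?thesis using t12 unfolding \<eta>_def by (simp add: field_simps)
    qed
    finally show ?thesis .
  qed
  thus "\<exists>no. \<forall>n\<ge>no. norm ((\<Sum>k<m n. u (r n k) * (r n (Suc k) - r n k)) - (LBINT s:{t1..t2}. u (ext s))) < e" by blast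
qed

lemma step_square_integral:
  fixes u :: "real \<Rightarrow> real"
  assumes "compact A" "continuous_on A u" "T \<inter> {t1..<t2} \<subseteq> A"
  shows "(\<lambda>n. LBINT s:{t1..t2}. (simple_proc (m n) (r n) (\<lambda>k _. u (r n k)) s w - u (ext s))\<^sup>2) \<longlonglongrightarrow> 0"
proof (rule LIMSEQ_I)
  fix e :: real assume e: "e > 0"
  define \<eta> where "\<eta> = sqrt (e / (2 * (t2 - t1 + 1)))"
  have \<eta>: "\<eta> > 0" using e t12 by (simp add: \<eta>_def)
  obtain N where N: "\<And>n s. n \<ge> N \<Longrightarrow> s \<in> {t1..<t2} \<Longrightarrow>
      \<bar>simple_proc (m n) (r n) (\<lambda>k _. u (r n k)) s w - u (ext s)\<bar> \<le> \<eta>"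
    using step_approx[OF assms \<eta>, of w] unfolding eventually_sequentially by blast
  have "norm ((LBINT s:{t1..t2}. (simple_proc (m n) (r n) (\<lambda>k _. u (r n k)) s w - u (ext s))\<^sup>2) - 0) < e" if n: "n \<ge> N" for n
  proof -
    let ?q = "\<lambda>s. (simple_proc (m n) (r n) (\<lambda>k _. u (r n k)) s w - u (ext s))\<^sup>2"
    have "(LBINT s:{t1..t2}. ?q s) \<le> (LBINT s. indicator {t1..t2} s * \<eta>\<^sup>2 )"
      unfolding set_lebesgue_integral_def
    proof (rule integral_mono_AE')
      have "AE s in lborel. s \<noteq> t2" by (rule AE_lborel_singleton)
      thus "AE s in lborel. indicator {t1..t2} s *\<^sub>R ?q s \<le> indicator {t1..t2} s * \<eta>\<^sup>2"
      proof eventually_elim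
        case (elim s)
        thus ?case using N[OF n, of s] \<eta> by (auto simp: indicator_def abs_le_square_iff[symmetric])
      qed
    qed (auto intro!: integrable_mult_left integrable_real_indicator simp: emeasure_lborel_Icc_eq)
    also have "\<dots> = \<eta>\<^sup>2 * (t2 - t1)" using t12 by simp
    also have "\<eta>\<^sup>2 = e / (2 * (t2 - t1 + 1))" using e t12 by (simp add: \<eta>_def)
    also have "\<dots> * (t2 - t1) < e"
    proof -
      have "e * (t2 - t1) < e * (2 * (t2 - t1 + 1))" using e t12 by (intro mult_strict_left_mono) auto
      thus ?thesis using t12 by (simp add: field_simps)
    qed
    finally show ?thesis by (simp add: set_lebesgue_integral_def)
  qed
  thus "\<exists>no. \<forall>n\<ge>no. norm ((LBINT s:{t1..t2}. (simple_proc (m n) (r n) (\<lambda>k _. u (r n k)) s w - u (ext s))\<^sup>2) - 0) < e" by blast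
qed

end

section \<open>Decomposition along a path\<close>

text \<open>Meant for a jump term, with \<open>l\<close> the length of the gap and \<open>d\<close>
  the increment of the path. The mixed product \<open>q * l * d\<close> is of order \<open>l\<close>
  because \<open>d\<close> is bounded by \<open>L\<close>; this is where \<open>C2 * L\<close> comes
  from.\<close>

lemma quadratic_remainder_bound:
  fixes C1 C2 L p q s d l :: real
  assumes p: "\<bar>p\<bar> \<le> C1" and q: "\<bar>q\<bar> \<le> C2" and s: "\<bar>s\<bar> \<le> C1" and d: "\<bar>d\<bar> \<le> L" and l: "0 \<le> l"
  shows "\<bar>1/2 * p * d\<^sup>2 + q * l * d - 1/2 * s * l\<bar> \<le> (C1 + C2 * L) * (l + d\<^sup>2)"
proof -
  have nn: "0 \<le> C1" "0 \<le> C2" "0 \<le> L" using p q d by linarith+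
  have "\<bar>1/2 * p * d\<^sup>2\<bar> \<le> C1 * d\<^sup>2"
    unfolding abs_mult[of _ "d\<^sup>2"] abs_power2 by (rule mult_right_mono) (use p nn in auto)
  moreover have "\<bar>q * l * d\<bar> \<le> C2 * l * L"
    unfolding abs_mult using q d l nn by (intro mult_mono) auto
  moreover have "\<bar>1/2 * s * l\<bar> \<le> C1 * l"
    unfolding abs_mult[of _ l] using s nn l by (intro mult_mono) auto
  moreover have "\<bar>1/2 * p * d\<^sup>2 + q * l * d - 1/2 * s * l\<bar> \<le> \<bar>1/2 * p * d\<^sup>2\<bar> + \<bar>q * l * d\<bar> + \<bar>1/2 * s * l\<bar>"
    by (rule order_trans[OF abs_triangle_ineq4 add_right_mono[OF abs_triangle_ineq]])
  ultimately have "\<bar>1/2 * p * d\<^sup>2 + q * l * d - 1/2 * s * l\<bar> \<le> C1 * d\<^sup>2 + C2 * l * L + C1 * l"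
    by linarith
  moreover have "0 \<le> C2 * L * d\<^sup>2" using nn by simp
  ultimately show ?thesis by (simp add: algebra_simps)
qed

locale ts_ito_function = ts_partition_seq +
  fixes f fd fx fxx fdx :: "real \<Rightarrow> real \<Rightarrow> real"
  assumes d1: "\<And>t x. t \<in> ts_kappa T \<Longrightarrow> has_delta_derivative T (\<lambda>s. f s x) (fd t x) t"
    and px1: "\<And>t x. t \<in> T \<Longrightarrow> ((\<lambda>y. f t y) has_real_derivative fx t x) (at x)"
    and px2: "\<And>t x. t \<in> T \<Longrightarrow> ((\<lambda>y. fx t y) has_real_derivative fxx t x) (at x)"
    and pdx1: "\<And>t x. t \<in> ts_kappa T \<Longrightarrow> ((\<lambda>y. fd t y) has_real_derivative fdx t x) (at x)"
    and c_fd: "continuous_on (ts_kappa T \<times> UNIV) (\<lambda>(t, x). fd t x)"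
    and c_fx: "continuous_on (T \<times> UNIV) (\<lambda>(t, x). fx t x)"
    and c_fxx: "continuous_on (T \<times> UNIV) (\<lambda>(t, x). fxx t x)"
    and c_fdx: "continuous_on (ts_kappa T \<times> UNIV) (\<lambda>(t, x). fdx t x)"
begin

definition "gap_term b a = f (\<sigma> a) (b (\<sigma> a)) - f (\<sigma> a) (b a) - fx a (b a) * (b (\<sigma> a) - b a)
   - 1/2 * fxx a (b a) * (\<sigma> a - a)"

context
  fixes n :: nat and b :: "real \<Rightarrow> real"
begin

definition "ito_sum = (\<Sum>k<m n. fx (r n k) (b (r n k)) * (b (r n (Suc k)) - b (r n k)))"

text \<open>The price of expanding in space at the later time. Short steps only: over a long gap
  this discrepancy stays in the jump term.\<close>

definition "mart_sum = (\<Sum>k<m n. if small n k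
   then (fx (r n (Suc k)) (b (r n k)) - fx (r n k) (b (r n k))) * (b (r n (Suc k)) - b (r n k)) else 0)"

definition "quad_sum = (\<Sum>k<m n. if small n k
   then 1/2 * fxx (r n k) (b (r n k)) * ((b (r n (Suc k)) - b (r n k))\<^sup>2 - (r n (Suc k) - r n k)) else 0)"

definition "taylor_sum = (\<Sum>k<m n. if small n k
   then f (r n (Suc k)) (b (r n (Suc k))) - f (r n (Suc k)) (b (r n k))
     - fx (r n (Suc k)) (b (r n k)) * (b (r n (Suc k)) - b (r n k))
     - 1/2 * fxx (r n k) (b (r n k)) * (b (r n (Suc k)) - b (r n k))\<^sup>2 else 0)"

text \<open>Not restricted to short steps: over a gap the time increment is exactly
  \<open>fd\<close> times the length, so it belongs to the time integral.\<close>

definition "time_sum = (\<Sum>k<m n. f (r n (Suc k)) (b (r n k)) - f (r n k) (b (r n k)))"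

definition "second_sum = (\<Sum>k<m n. fxx (r n k) (b (r n k)) * (r n (Suc k) - r n k))"

definition "sq_sum = (\<Sum>k<m n. (b (r n (Suc k)) - b (r n k))\<^sup>2)"

text \<open>A telescoping identity valid for every path, without continuity or probability. On a
  long step \<open>\<sigma> (r n k) = r n (Suc k)\<close>, so the subtracted terms of
  \<open>gap_term\<close> cancel what \<open>ito_sum\<close> and \<open>second_sum\<close>
  contribute there.\<close>

lemma decomposition:
  "f t2 (b t2) - f t1 (b t1) =
     ito_sum + mart_sum + quad_sum + taylor_sum + (\<Sum>a\<in>long_gaps n. gap_term b a) + time_sum + 1/2 * second_sum"
proof -
  have "f t2 (b t2) - f t1 (b t1) = (\<Sum>k<m n. f (r n (Suc k)) (b (r n (Suc k))) - f (r n k) (b (r n k)))"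
    using sum_lessThan_telescope[of "\<lambda>k. f (r n k) (b (r n k))" "m n"] part[of n]
    by (simp add: ts_partition_def)
  also have "\<dots> = ito_sum + mart_sum + quad_sum + taylor_sum + (\<Sum>a\<in>long_gaps n. gap_term b a) + time_sum + 1/2 * second_sum"
    unfolding ito_sum_def mart_sum_def quad_sum_def taylor_sum_def time_sum_def second_sum_def
      sum_long_gaps sum_distrib_left sum.distrib[symmetric]
  proof (rule sum.cong)
    fix k assume "k \<in> {..<m n}"
    thus "f (r n (Suc k)) (b (r n (Suc k))) - f (r n k) (b (r n k)) =
      fx (r n k) (b (r n k)) * (b (r n (Suc k)) - b (r n k)) +
      (if small n k then (fx (r n (Suc k)) (b (r n k)) - fx (r n k) (b (r n k))) * (b (r n (Suc k)) - b (r n k)) else 0) +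
      (if small n k then 1/2 * fxx (r n k) (b (r n k)) * ((b (r n (Suc k)) - b (r n k))\<^sup>2 - (r n (Suc k) - r n k)) else 0) +
      (if small n k then f (r n (Suc k)) (b (r n (Suc k))) - f (r n (Suc k)) (b (r n k))
         - fx (r n (Suc k)) (b (r n k)) * (b (r n (Suc k)) - b (r n k))
         - 1/2 * fxx (r n k) (b (r n k)) * (b (r n (Suc k)) - b (r n k))\<^sup>2 else 0) +
      (if small n k then 0 else gap_term b (r n k)) +
      (f (r n (Suc k)) (b (r n k)) - f (r n k) (b (r n k))) +
      1/2 * (fxx (r n k) (b (r n k)) * (r n (Suc k) - r n k))"
      using sigma_not_small[of k n] by (cases "small n k") (simp_all add: gap_term_def algebra_simps diff_divide_distrib)
  qed simp
  finally show ?thesis .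
qed

end

section \<open>Limits of the sums along a fixed continuous path\<close>

context
  fixes b :: "real \<Rightarrow> real"
  assumes b: "continuous_on {t1..t2} b"
begin

lemma strip_uniform:
  fixes h :: "real \<Rightarrow> real \<Rightarrow> real"
  assumes "closed A" "continuous_on (A \<times> UNIV) (\<lambda>(t, x). h t x)" "\<eta> > 0"
  shows "\<forall>\<^sub>F n in sequentially. \<forall>k<m n. \<forall>t \<xi>. small n k \<longrightarrow> r n k \<in> A \<longrightarrow> t \<in> A \<longrightarrow> r n k \<le> t \<longrightarrow> t \<le> r n (Suc k) \<longrightarrow>
     \<bar>\<xi> - b (r n k)\<bar> \<le> \<bar>b (r n (Suc k)) - b (r n k)\<bar> \<longrightarrow>
     \<bar>h t \<xi> - h (r n k) (b (r n k))\<bar> < \<eta>"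
proof -
  obtain K where K: "K > 0" "\<And>t. t1 \<le> t \<Longrightarrow> t \<le> t2 \<Longrightarrow> \<bar>b t\<bar> \<le> K" using bounded_path[OF b] by metis
  \<comment> \<open>With \<open>b\<close> bounded by \<open>K\<close>, the point \<xi> is at most
    \<open>2 * K\<close> away from \<open>b (r n k)\<close>, whence \<open>3 * K\<close>.\<close>
  obtain d where d: "d > 0"
    "\<And>t t' x x'. \<lbrakk>t \<in> A; t' \<in> A; t1 \<le> t; t \<le> t2; t1 \<le> t'; t' \<le> t2; \<bar>x\<bar> \<le> 3 * K; \<bar>x'\<bar> \<le> 3 * K; \<bar>t - t'\<bar> < d; \<bar>x - x'\<bar> < d\<rbrakk>
        \<Longrightarrow> \<bar>h t x - h t' x'\<bar> < \<eta>"
    using uniformly_continuous_strip[OF assms, of t1 t2 "3 * K"] by metis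
  obtain d' where d': "d' > 0" "\<And>t t'. \<lbrakk>t1 \<le> t; t \<le> t2; t1 \<le> t'; t' \<le> t2; \<bar>t - t'\<bar> < d'\<rbrakk> \<Longrightarrow> \<bar>b t - b t'\<bar> < d"
    using uniformly_continuous_path[OF b d(1)] by metis
  have "\<forall>\<^sub>F n in sequentially. \<delta> n < min d d'" using d d' by (intro eventually_\<delta>_less) auto
  thus ?thesis
  proof (eventually_elim, intro allI impI)
    fix n k t \<xi>
    assume n: "\<delta> n < min d d'" and k: "k < m n" "small n k" "r n k \<in> A" "t \<in> A" "r n k \<le> t" "t \<le> r n (Suc k)"
      and x: "\<bar>\<xi> - b (r n k)\<bar> \<le> \<bar>b (r n (Suc k)) - b (r n k)\<bar>"
    note pk = part_in[OF k(1)]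
    have len: "r n (Suc k) - r n k < min d d'" using k n by (simp add: small_def)
    have "\<bar>b (r n (Suc k)) - b (r n k)\<bar> < d" using pk len by (intro d'(2)) auto
    hence "\<bar>\<xi> - b (r n k)\<bar> < d" using x by linarith
    moreover have bk: "\<bar>b (r n k)\<bar> \<le> K" by (rule K(2)) (use pk in auto)
    moreover have "\<bar>b (r n (Suc k))\<bar> \<le> K" by (rule K(2)) (use pk in auto)
    hence "\<bar>\<xi>\<bar> \<le> 3 * K" using x bk by linarith
    moreover have "\<bar>b (r n k)\<bar> \<le> 3 * K" using bk K(1) by linarith
    moreover have "\<bar>t - r n k\<bar> < d" using k len by linarith
    moreover have "t1 \<le> t" "t \<le> t2" "t1 \<le> r n k" "r n k \<le> t2" using k pk by linarith+
    ultimately show "\<bar>h t \<xi> - h (r n k) (b (r n k))\<bar> < \<eta>" using k by (intro d(2))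
  qed
qed

text \<open>Taylor's formula produces \<open>fxx\<close> at the right endpoint and an intermediate
  point, which on a short step is within \<eta> of the coefficient at the left endpoint. From which
  \<open>n\<close> on this holds depends on the path.\<close>

lemma taylor_sum_bound:
  assumes "\<eta> > 0"
  shows "\<forall>\<^sub>F n in sequentially. \<bar>taylor_sum n b\<bar> \<le> \<eta> * sq_sum n b"
  using strip_uniform[OF T c_fxx assms]
proof eventually_elim
  case (elim n)
  show ?case unfolding taylor_sum_def sq_sum_def sum_distrib_left
  proof (intro order_trans[OF sum_abs] sum_mono)
    fix k assume "k \<in> {..<m n}"
    hence k: "k < m n" by simp
    note pk = part_in[OF k]
    let ?t = "r n (Suc k)" and ?x = "b (r n k)" and ?y = "b (r n (Suc k))"
    show "\<bar>if small n k then f ?t ?y - f ?t ?x - fx ?t ?x * (?y - ?x) - 1/2 * fxx (r n k) ?x * (?y - ?x)\<^sup>2 else 0\<bar>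
      \<le> \<eta> * (?y - ?x)\<^sup>2"
    proof (cases "small n k")
      case True
      obtain \<xi> where \<xi>: "\<bar>\<xi> - ?x\<bar> \<le> \<bar>?y - ?x\<bar>" "f ?t ?y = f ?t ?x + fx ?t ?x * (?y - ?x) + 1/2 * fxx ?t \<xi> * (?y - ?x)\<^sup>2"
        using taylor2[OF px1[OF pk(4)] px2[OF pk(4)], of ?x ?y] by metis
      have "\<bar>fxx ?t \<xi> - fxx (r n k) ?x\<bar> < \<eta>" using elim k True pk \<xi> by auto
      hence "\<bar>1/2 * (fxx ?t \<xi> - fxx (r n k) ?x)\<bar> \<le> \<eta>" by simp
      hence "\<bar>1/2 * (fxx ?t \<xi> - fxx (r n k) ?x) * (?y - ?x)\<^sup>2\<bar> \<le> \<eta> * (?y - ?x)\<^sup>2"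
        unfolding abs_mult[of _ "(?y - ?x)\<^sup>2"] abs_power2 by (rule mult_right_mono) simp
      moreover have "f ?t ?y - f ?t ?x - fx ?t ?x * (?y - ?x) - 1/2 * fxx (r n k) ?x * (?y - ?x)\<^sup>2
        = 1/2 * (fxx ?t \<xi> - fxx (r n k) ?x) * (?y - ?x)\<^sup>2"
        unfolding \<xi>(2) by (simp add: algebra_simps)
      ultimately show ?thesis using True by simp
    qed (use assms in simp)
  qed
qed

lemma path_composition_continuous:
  fixes h :: "real \<Rightarrow> real \<Rightarrow> real"
  assumes "continuous_on (A \<times> UNIV) (\<lambda>(t, x). h t x)"
  shows "continuous_on (A \<inter> {t1..t2}) (\<lambda>t. h t (b t))"
proof -
  have "continuous_on (A \<inter> {t1..t2}) (\<lambda>t. (t, b t))"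
    by (intro continuous_intros continuous_on_subset[OF b]) auto
  hence "continuous_on (A \<inter> {t1..t2}) ((\<lambda>(t, x). h t x) \<circ> (\<lambda>t. (t, b t)))"
    by (intro continuous_on_compose continuous_on_subset[OF assms]) auto
  thus ?thesis by (simp add: comp_def)
qed

lemma second_sum_tendsto: "(\<lambda>n. second_sum n b) \<longlonglongrightarrow> (LBINT s:{t1..t2}. fxx (ext s) (b (ext s)))"
  unfolding second_sum_def
  by (rule riemann_tendsto[OF closed_Int_compact[OF T compact_Icc] path_composition_continuous[OF c_fxx]]) auto

lemma ito_step_square_integral:
  "(\<lambda>n. LBINT s:{t1..t2}. (simple_proc (m n) (r n) (\<lambda>k _. fx (r n k) (b (r n k))) s w - fx (ext s) (b (ext s)))\<^sup>2) \<longlonglongrightarrow> 0"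
  by (rule step_square_integral[OF closed_Int_compact[OF T compact_Icc] path_composition_continuous[OF c_fx]]) auto

text \<open>On each step the mean value inequality is used with the space argument frozen and with
  the derivative at the left endpoint as \<open>c\<close>. The oscillation of \<open>fd\<close> is
  small on short steps; on long ones the left endpoint is the only point of \<open>T\<close> to
  check, and there it is 0.\<close>

lemma time_sum_tendsto: "(\<lambda>n. time_sum n b) \<longlonglongrightarrow> (LBINT s:{t1..t2}. fd (ext s) (b (ext s)))"
proof -
  let ?D = "\<lambda>n. \<Sum>k<m n. fd (r n k) (b (r n k)) * (r n (Suc k) - r n k)"
  \<comment> \<open>\<open>t2\<close> may be a left-scattered maximum, where no delta derivative is
    given; all earlier points of \<open>T\<close> lie in \<open>ts_kappa T\<close>.\<close>
  have sub: "T \<inter> {t1..<t2} \<subseteq> ts_kappa T \<inter> {t1..t2}" using ts_kappaI[OF _ t2T] by auto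
  have lim: "?D \<longlonglongrightarrow> (LBINT s:{t1..t2}. fd (ext s) (b (ext s)))"
    by (rule riemann_tendsto[OF closed_Int_compact[OF closed_ts_kappa[OF T] compact_Icc]
          path_composition_continuous[OF c_fd] sub])
  have "(\<lambda>n. time_sum n b - ?D n) \<longlonglongrightarrow> 0"
  proof (rule LIMSEQ_I)
    fix e :: real assume e: "e > 0"
    define \<eta> where "\<eta> = e / (2 * (t2 - t1 + 1))"
    have \<eta>: "\<eta> > 0" using e t12 by (simp add: \<eta>_def)
    have "\<eta> * (t2 - t1) < e"
    proof -
      have "e * (t2 - t1) < e * (2 * (t2 - t1 + 1))" using e t12 by (intro mult_strict_left_mono) auto
      thus ?thesis using t12 unfolding \<eta>_def by (simp add: field_simps)
    qed
    have "\<forall>\<^sub>F n in sequentially. norm (time_sum n b - ?D n - 0) < e"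
      using strip_uniform[OF closed_ts_kappa[OF T] c_fd \<eta>]
    proof eventually_elim
      case (elim n)
      have "\<bar>time_sum n b - ?D n\<bar> \<le> (\<Sum>k<m n. \<eta> * (r n (Suc k) - r n k))"
        unfolding time_sum_def sum_subtractf[symmetric]
      proof (intro order_trans[OF sum_abs] sum_mono)
        fix k assume "k \<in> {..<m n}"
        hence k: "k < m n" by simp
        note pk = part_in[OF k]
        show "\<bar>f (r n (Suc k)) (b (r n k)) - f (r n k) (b (r n k)) - fd (r n k) (b (r n k)) * (r n (Suc k) - r n k)\<bar>
          \<le> \<eta> * (r n (Suc k) - r n k)"
        proof (rule delta_mean_value[OF T pk(1,4) less_imp_le[OF pk(7)] d1])
          fix t assume t: "t \<in> T" "r n k \<le> t" "t < r n (Suc k)"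
          show "\<bar>fd t (b (r n k)) - fd (r n k) (b (r n k))\<bar> \<le> \<eta>"
          proof (cases "t = r n k")
            case False
            hence "t \<in> {r n k<..<r n (Suc k)} \<inter> T" using t by auto
            hence "small n k" using part_step(2)[OF k] by (auto simp: small_def)
            moreover have "t \<in> ts_kappa T" by (rule ts_kappaI[OF t(1) pk(4) t(3)])
            ultimately have "\<bar>fd t (b (r n k)) - fd (r n k) (b (r n k))\<bar> < \<eta>"
              using elim k pk t by auto
            thus ?thesis by simp
          qed (use \<eta> in simp)
        qed
      qed
      also have "\<dots> = \<eta> * (t2 - t1)" by (rule sum_steps)
      also have "\<dots> < e" by fact
      finally show ?case by simp
    qed
    thus "\<exists>no. \<forall>n\<ge>no. norm (time_sum n b - ?D n - 0) < e" unfolding eventually_sequentially .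
  qed
  from tendsto_add[OF this lim] show ?thesis by simp
qed

text \<open>The part of the jump term that is linear in the increment has the coefficient
  \<open>fx (\<sigma> a) (b a) - fx a (b a)\<close>. The mixed derivative shows that it equals
  \<open>fdx a (b a) * (\<sigma> a - a)\<close>, so this part is of the order of the gap length; the
  rest is of second order by Taylor's formula at time \<open>\<sigma> a\<close>.\<close>

lemma gap_term_bound:
  obtains C where "C \<ge> 0" "\<And>a. a \<in> gaps \<Longrightarrow> \<bar>gap_term b a\<bar> \<le> C * ((\<sigma> a - a) + (b (\<sigma> a) - b a)\<^sup>2)"
proof -
  obtain K where K: "K > 0" "\<And>t. t1 \<le> t \<Longrightarrow> t \<le> t2 \<Longrightarrow> \<bar>b t\<bar> \<le> K" using bounded_path[OF b] by metis
  obtain C1 where C1: "C1 \<ge> 0" "\<And>t x. \<lbrakk>t \<in> T; t1 \<le> t; t \<le> t2; \<bar>x\<bar> \<le> K\<rbrakk> \<Longrightarrow> \<bar>fxx t x\<bar> \<le> C1"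
    using bounded_strip[OF T c_fxx, of t1 t2 K] by metis
  obtain C2 where C2: "C2 \<ge> 0" "\<And>t x. \<lbrakk>t \<in> ts_kappa T; t1 \<le> t; t \<le> t2; \<bar>x\<bar> \<le> K\<rbrakk> \<Longrightarrow> \<bar>fdx t x\<bar> \<le> C2"
    using bounded_strip[OF closed_ts_kappa[OF T] c_fdx, of t1 t2 K] by metis
  show ?thesis
  proof (rule that[of "C1 + C2 * (2 * K)"])
    fix a assume a: "a \<in> gaps"
    hence a': "a \<in> T" "a < \<sigma> a" "t1 \<le> a" "\<sigma> a \<le> t2" "a < t2" by (auto simp: ts_gaps_in_def)
    have sT: "\<sigma> a \<in> T" using ts_sigma_props(1)[OF T a'(1) t2T a'(5)] .
    have ka: "a \<in> ts_kappa T" by (rule ts_kappaI[OF a'(1) t2T a'(5)])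
    let ?x = "b a" and ?y = "b (\<sigma> a)"
    have xy: "\<bar>?x\<bar> \<le> K" "\<bar>?y\<bar> \<le> K" using a' by (auto intro!: K(2))
    have fdx_eq: "fx (\<sigma> a) ?x - fx a ?x = fdx a ?x * (\<sigma> a - a)"
    proof (rule DERIV_unique)
      show "((\<lambda>y. f (\<sigma> a) y - f a y) has_real_derivative fx (\<sigma> a) ?x - fx a ?x) (at ?x)"
        by (intro DERIV_diff px1 sT a')
      \<comment> \<open>At the right-scattered point \<open>a\<close> the identity is exact for
        every \<open>y\<close>, so it may be differentiated in \<open>y\<close>.\<close>
      have "(\<lambda>y. f (\<sigma> a) y - f a y) = (\<lambda>y. fd a y * (\<sigma> a - a))"
        using delta_derivative_scattered[OF d1[OF ka] a'(1)] by auto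
      thus "((\<lambda>y. f (\<sigma> a) y - f a y) has_real_derivative fdx a ?x * (\<sigma> a - a)) (at ?x)"
        using DERIV_cmult_right[OF pdx1[OF ka, of ?x]] by simp
    qed
    obtain \<xi> where \<xi>: "\<xi> \<in> {min ?x ?y..max ?x ?y}"
      "f (\<sigma> a) ?y = f (\<sigma> a) ?x + fx (\<sigma> a) ?x * (?y - ?x) + 1/2 * fxx (\<sigma> a) \<xi> * (?y - ?x)\<^sup>2"
      using taylor2[OF px1[OF sT] px2[OF sT], of ?x ?y] by metis
    have xK: "\<bar>\<xi>\<bar> \<le> K" using \<xi>(1) xy by (auto simp: min_def max_def split: if_splits)
    have "gap_term b a = 1/2 * fxx (\<sigma> a) \<xi> * (?y - ?x)\<^sup>2 + fdx a ?x * (\<sigma> a - a) * (?y - ?x) - 1/2 * fxx a ?x * (\<sigma> a - a)"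
      unfolding gap_term_def \<xi>(2) fdx_eq[symmetric] by (simp add: algebra_simps)
    also have "\<bar>\<dots>\<bar> \<le> (C1 + C2 * (2 * K)) * ((\<sigma> a - a) + (?y - ?x)\<^sup>2)"
    proof (rule quadratic_remainder_bound)
      show "\<bar>fxx (\<sigma> a) \<xi>\<bar> \<le> C1" by (rule C1(2)[OF sT _ _ xK]) (use a' in auto)
      show "\<bar>fdx a ?x\<bar> \<le> C2" by (rule C2(2)[OF ka _ _ xy(1)]) (use a' in auto)
      show "\<bar>fxx a ?x\<bar> \<le> C1" by (rule C1(2)[OF a'(1) _ _ xy(1)]) (use a' in auto)
      show "\<bar>?y - ?x\<bar> \<le> 2 * K" using xy by linarith
    qed (use a' in simp)
    finally show "\<bar>gap_term b a\<bar> \<le> (C1 + C2 * (2 * K)) * ((\<sigma> a - a) + (?y - ?x)\<^sup>2)" .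
  qed (use C1 C2 K in simp)
qed

text \<open>Every finite set of gaps lies in some \<open>long_gaps n\<close>, so \<open>c\<close>
  and the total gap length bound all finite sums of absolute values.\<close>

lemma gap_term_summable:
  assumes "\<And>n. (\<Sum>a\<in>long_gaps n. (b (\<sigma> a) - b a)\<^sup>2) \<le> c"
  shows "gap_term b summable_on gaps"
proof -
  obtain C where C: "C \<ge> 0" "\<And>a. a \<in> gaps \<Longrightarrow> \<bar>gap_term b a\<bar> \<le> C * ((\<sigma> a - a) + (b (\<sigma> a) - b a)\<^sup>2)"
    using gap_term_bound by metis
  have "(\<lambda>a. norm (gap_term b a)) summable_on gaps"
  proof (rule nonneg_bdd_above_summable_on)
    show "bdd_above (sum (\<lambda>a. norm (gap_term b a)) ` {G. G \<subseteq> gaps \<and> finite G})"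
    proof (rule bdd_aboveI2)
      fix G assume "G \<in> {G. G \<subseteq> gaps \<and> finite G}"
      hence G: "G \<subseteq> gaps" "finite G" by auto
      obtain n where n: "G \<subseteq> long_gaps n"
        using finite_gaps_eventually_long[OF G(2,1)] eventually_happens by force
      have "(\<Sum>a\<in>G. norm (gap_term b a)) \<le> (\<Sum>a\<in>G. C * ((\<sigma> a - a) + (b (\<sigma> a) - b a)\<^sup>2))"
        using C G by (intro sum_mono) auto
      also have "\<dots> = C * ((\<Sum>a\<in>G. \<sigma> a - a) + (\<Sum>a\<in>G. (b (\<sigma> a) - b a)\<^sup>2))"
        by (simp add: sum_distrib_left[symmetric] sum.distrib)
      also have "\<dots> \<le> C * ((t2 - t1) + c)"
      proof (intro mult_left_mono add_mono C)
        show "(\<Sum>a\<in>G. \<sigma> a - a) \<le> t2 - t1" by (rule sum_gap_lengths_le[OF T G(2,1) t2T t12])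
        have "(\<Sum>a\<in>G. (b (\<sigma> a) - b a)\<^sup>2) \<le> (\<Sum>a\<in>long_gaps n. (b (\<sigma> a) - b a)\<^sup>2)"
          by (rule sum_mono2[OF finite_long_gaps' n]) simp
        thus "(\<Sum>a\<in>G. (b (\<sigma> a) - b a)\<^sup>2) \<le> c" using assms[of n] by simp
      qed
      finally show "(\<Sum>a\<in>G. norm (gap_term b a)) \<le> C * ((t2 - t1) + c)" .
    qed
  qed simp
  thus ?thesis by (rule abs_summable_summable)
qed

end

end

section \<open>Convergence in probability and orthogonality\<close>

context prob_space
begin

lemma prob_tendsto_zero:
  assumes A: "\<And>n. A n \<in> events" and ev: "AE \<omega> in M. \<forall>\<^sub>F n in sequentially. \<omega> \<notin> A n"
  shows "(\<lambda>n. prob (A n)) \<longlonglongrightarrow> 0"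
proof -
  have "(\<lambda>n. \<integral>\<omega>. indicator (A n) \<omega> \<partial>M) \<longlonglongrightarrow> (\<integral>\<omega>. 0 \<partial>M :: real)"
  proof (rule integral_dominated_convergence[where w = "\<lambda>_. 1"])
    show "AE \<omega> in M. (\<lambda>n. indicator (A n) \<omega> :: real) \<longlonglongrightarrow> 0"
      using ev
    proof eventually_elim
      case (elim \<omega>)
      thus ?case by (intro tendsto_eventually) (auto elim: eventually_mono)
    qed
  qed (use A in \<open>auto simp: indicator_def\<close>)
  thus ?thesis using A by simp
qed

text \<open>Sets that are not measurable have measure \<open>0\<close>, so measurability is not an issue here.\<close>

lemma conv_in_prob_AE:
  assumes "AE \<omega> in M. (\<lambda>n. Y n \<omega>) \<longlonglongrightarrow> Z \<omega>"
  shows "conv_in_prob M Y Z"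
  unfolding conv_in_prob_def
proof (intro allI impI)
  fix \<epsilon> :: real assume e: "\<epsilon> > 0"
  define S where "S n = {\<omega>\<in>space M. \<bar>Y n \<omega> - Z \<omega>\<bar> > \<epsilon>}" for n
  define A where "A n = (if S n \<in> events then S n else {})" for n
  have "(\<lambda>n. prob (A n)) \<longlonglongrightarrow> 0"
  proof (rule prob_tendsto_zero)
    show "AE \<omega> in M. \<forall>\<^sub>F n in sequentially. \<omega> \<notin> A n"
      using assms
    proof eventually_elim
      case (elim \<omega>)
      from tendstoD[OF this e] show ?case
        by eventually_elim (auto simp: A_def S_def dist_real_def)
    qed
  qed (auto simp: A_def)
  moreover have "prob (A n) = prob (S n)" for n by (simp add: A_def measure_notin_sets)
  ultimately show "(\<lambda>n. prob {\<omega>\<in>space M. \<bar>Y n \<omega> - Z \<omega>\<bar> > \<epsilon>}) \<longlonglongrightarrow> 0"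
    by (simp add: S_def)
qed

lemma conv_in_prob_diff:
  fixes Y N :: "nat \<Rightarrow> 'a \<Rightarrow> real" and Z :: "'a \<Rightarrow> real"
  assumes Y: "conv_in_prob M Y Z" and N: "conv_in_prob M N (\<lambda>_. 0)"
    and [measurable]: "\<And>n. Y n \<in> borel_measurable M" "\<And>n. N n \<in> borel_measurable M" "Z \<in> borel_measurable M"
  shows "conv_in_prob M (\<lambda>n \<omega>. Y n \<omega> - N n \<omega>) Z"
  unfolding conv_in_prob_def
proof (intro allI impI)
  fix \<epsilon> :: real assume e: "\<epsilon> > 0"
  let ?A = "\<lambda>n. {\<omega>\<in>space M. \<bar>Y n \<omega> - Z \<omega>\<bar> > \<epsilon> / 2}" and ?B = "\<lambda>n. {\<omega>\<in>space M. \<bar>N n \<omega> - 0\<bar> > \<epsilon> / 2}"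
  have lim: "(\<lambda>n. prob (?A n) + prob (?B n)) \<longlonglongrightarrow> 0 + 0"
    using Y[unfolded conv_in_prob_def, rule_format, of "\<epsilon> / 2"] N[unfolded conv_in_prob_def, rule_format, of "\<epsilon> / 2"] e
    by (intro tendsto_add) simp_all
  show "(\<lambda>n. prob {\<omega>\<in>space M. \<bar>Y n \<omega> - N n \<omega> - Z \<omega>\<bar> > \<epsilon>}) \<longlonglongrightarrow> 0"
  proof (rule tendsto_sandwich[OF _ _ tendsto_const])
    show "(\<lambda>n. prob (?A n) + prob (?B n)) \<longlonglongrightarrow> 0" using lim by simp
    have "prob {\<omega>\<in>space M. \<bar>Y n \<omega> - N n \<omega> - Z \<omega>\<bar> > \<epsilon>} \<le> prob (?A n \<union> ?B n)" for n
    proof (rule finite_measure_mono)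
      have "\<bar>Y n \<omega> - Z \<omega>\<bar> > \<epsilon> / 2 \<or> \<bar>N n \<omega> - 0\<bar> > \<epsilon> / 2" if "\<bar>Y n \<omega> - N n \<omega> - Z \<omega>\<bar> > \<epsilon>" for \<omega>
        using that by linarith
      thus "{\<omega>\<in>space M. \<bar>Y n \<omega> - N n \<omega> - Z \<omega>\<bar> > \<epsilon>} \<subseteq> ?A n \<union> ?B n" by blast
    qed measurable
    also have "prob (?A n \<union> ?B n) \<le> prob (?A n) + prob (?B n)" for n
      by (rule measure_Un_le) measurable
    finally show "\<forall>\<^sub>F n in sequentially. prob {\<omega>\<in>space M. \<bar>Y n \<omega> - N n \<omega> - Z \<omega>\<bar> > \<epsilon>} \<le> prob (?A n) + prob (?B n)"
      by simp
  qed simp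
qed

text \<open>From which \<open>n\<close> on the bound by \<open>\<eta> * Q n\<close> holds depends on
  \<open>\<omega>\<close>, so it does not bound the expectation of \<open>R n\<close>. The events
  where it fails have probability tending to 0, however, and outside them Markov's inequality for
  \<open>Q n\<close> applies.\<close>

lemma conv_in_prob_dominated:
  fixes R Q :: "nat \<Rightarrow> 'a \<Rightarrow> real"
  assumes [measurable]: "\<And>n. R n \<in> borel_measurable M" and Q: "\<And>n. integrable M (Q n)"
    and nn: "\<And>n \<omega>. 0 \<le> Q n \<omega>" and c: "\<And>n. expectation (Q n) \<le> c"
    and bd: "\<And>\<eta>. \<eta> > 0 \<Longrightarrow> AE \<omega> in M. \<forall>\<^sub>F n in sequentially. \<bar>R n \<omega>\<bar> \<le> \<eta> * Q n \<omega>"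
  shows "conv_in_prob M R (\<lambda>_. 0)"
  unfolding conv_in_prob_def diff_zero
proof (intro allI impI LIMSEQ_I)
  fix \<epsilon> e :: real assume e: "\<epsilon> > 0" "e > 0"
  have [measurable]: "Q n \<in> borel_measurable M" for n using Q by simp
  have "0 \<le> expectation (Q 0)" using nn by simp
  hence c0: "0 \<le> c" using c[of 0] by simp
  \<comment> \<open>Markov's inequality yields \<open>c * \<eta> / \<epsilon>\<close>, which this
    choice keeps below \<open>e / 2\<close>; \<open>c + 1\<close> excludes division by 0.\<close>
  define \<eta> where "\<eta> = e * \<epsilon> / (2 * (c + 1))"
  have \<eta>: "\<eta> > 0" using e c0 by (simp add: \<eta>_def)
  let ?A = "\<lambda>n. {\<omega>\<in>space M. \<not> \<bar>R n \<omega>\<bar> \<le> \<eta> * Q n \<omega>}" and ?B = "\<lambda>n. {\<omega>\<in>space M. Q n \<omega> \<ge> \<epsilon> / \<eta>}"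
  have "(\<lambda>n. prob (?A n)) \<longlonglongrightarrow> 0"
    by (rule prob_tendsto_zero) (use bd[OF \<eta>] in \<open>auto elim: eventually_mono\<close>)
  hence "\<forall>\<^sub>F n in sequentially. prob (?A n) < e / 2" using e by (intro order_tendstoD) auto
  then obtain N where N: "\<And>n. n \<ge> N \<Longrightarrow> prob (?A n) < e / 2" unfolding eventually_sequentially by blast
  have "norm (prob {\<omega>\<in>space M. \<bar>R n \<omega>\<bar> > \<epsilon>} - 0) < e" if n: "n \<ge> N" for n
  proof -
    have "prob {\<omega>\<in>space M. \<bar>R n \<omega>\<bar> > \<epsilon>} \<le> prob (?A n \<union> ?B n)"
      by (rule finite_measure_mono) (use \<eta> in \<open>auto simp: field_simps\<close>)
    also have "\<dots> \<le> prob (?A n) + prob (?B n)"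
      by (rule measure_Un_le) measurable
    also have "prob (?B n) \<le> expectation (Q n) / (\<epsilon> / \<eta>)"
      by (rule integral_Markov_inequality_measure[OF Q sets.top]) (use nn e \<eta> in auto)
    also have "\<dots> \<le> c / (\<epsilon> / \<eta>)" using c e \<eta> by (intro divide_right_mono) auto
    also have "\<dots> = c * (e / (2 * (c + 1)))" using e by (simp add: \<eta>_def)
    also have "\<dots> \<le> (c + 1) * (e / (2 * (c + 1)))" using e c0 by (intro mult_right_mono) auto
    also have "\<dots> = e / 2" using c0 by (simp add: divide_eq_eq algebra_simps)
    finally show ?thesis using N[OF n] by simp
  qed
  thus "\<exists>no. \<forall>n\<ge>no. norm (prob {\<omega>\<in>space M. \<bar>R n \<omega>\<bar> > \<epsilon>} - 0) < e" by blast
qed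

text \<open>Coefficients bounded only on compact sets give no second moments for \<open>U\<close>
  itself. Outside \<open>V K\<close> it equals \<open>U' K\<close>, to which Chebyshev's inequality
  applies. \<open>K\<close> is fixed before \<open>n\<close>, so the rate in \<open>n\<close> may
  depend on \<open>K\<close>.\<close>

lemma conv_in_prob_localized:
  fixes U :: "nat \<Rightarrow> 'a \<Rightarrow> real" and U' :: "nat \<Rightarrow> nat \<Rightarrow> 'a \<Rightarrow> real"
  assumes [measurable]: "\<And>n. U n \<in> borel_measurable M" "\<And>K n. U' K n \<in> borel_measurable M"
    and V: "\<And>K. V K \<in> events" and Vlim: "(\<lambda>K. prob (V K)) \<longlonglongrightarrow> 0"
    and eq: "\<And>K n \<omega>. \<omega> \<in> space M \<Longrightarrow> \<omega> \<notin> V K \<Longrightarrow> U n \<omega> = U' K n \<omega>"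
    and L2: "\<And>K e. e > 0 \<Longrightarrow> \<forall>\<^sub>F n in sequentially. integrable M (\<lambda>\<omega>. (U' K n \<omega>)\<^sup>2) \<and> expectation (\<lambda>\<omega>. (U' K n \<omega>)\<^sup>2) \<le> e"
  shows "conv_in_prob M U (\<lambda>_. 0)"
  unfolding conv_in_prob_def diff_zero
proof (intro allI impI LIMSEQ_I)
  fix \<epsilon> e :: real assume e: "\<epsilon> > 0" "e > 0"
  have "\<forall>\<^sub>F K in sequentially. prob (V K) < e / 2" using e Vlim by (intro order_tendstoD) auto
  then obtain K where K: "prob (V K) < e / 2" using eventually_happens by force
  obtain N where N: "\<And>n. n \<ge> N \<Longrightarrow> integrable M (\<lambda>\<omega>. (U' K n \<omega>)\<^sup>2)"
    "\<And>n. n \<ge> N \<Longrightarrow> expectation (\<lambda>\<omega>. (U' K n \<omega>)\<^sup>2) \<le> e / 2 * \<epsilon>\<^sup>2"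
    using L2[of "e / 2 * \<epsilon>\<^sup>2" K] e unfolding eventually_sequentially by auto
  have "norm (prob {\<omega>\<in>space M. \<bar>U n \<omega>\<bar> > \<epsilon>} - 0) < e" if n: "n \<ge> N" for n
  proof -
    let ?B = "{\<omega>\<in>space M. (U' K n \<omega>)\<^sup>2 \<ge> \<epsilon>\<^sup>2}"
    have "prob {\<omega>\<in>space M. \<bar>U n \<omega>\<bar> > \<epsilon>} \<le> prob (V K \<union> ?B)"
    proof (rule finite_measure_mono)
      show "{\<omega>\<in>space M. \<bar>U n \<omega>\<bar> > \<epsilon>} \<subseteq> V K \<union> ?B"
        using eq[of _ K n] e by (auto simp: abs_le_square_iff[symmetric])
      have [measurable]: "V K \<in> events" by (rule V)
      show "V K \<union> ?B \<in> events" by measurable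
    qed
    also have "\<dots> \<le> prob (V K) + prob ?B"
      by (rule measure_Un_le[OF V]) measurable
    also have "prob ?B \<le> expectation (\<lambda>\<omega>. (U' K n \<omega>)\<^sup>2) / \<epsilon>\<^sup>2"
      by (rule integral_Markov_inequality_measure[OF N(1)[OF n] sets.top]) (use e in auto)
    also have "\<dots> \<le> (e / 2 * \<epsilon>\<^sup>2) / \<epsilon>\<^sup>2" by (rule divide_right_mono[OF N(2)[OF n]]) simp
    also have "\<dots> = e / 2" using e by simp
    finally show ?thesis using K by simp
  qed
  thus "\<exists>no. \<forall>n\<ge>no. norm (prob {\<omega>\<in>space M. \<bar>U n \<omega>\<bar> > \<epsilon>} - 0) < e" by blast
qed

end

section \<open>Brownian increments: moments, independence, martingale sums\<close>

locale brownian =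
  fixes M :: "'a measure" and F :: "real \<Rightarrow> 'a measure" and B :: "real \<Rightarrow> 'a \<Rightarrow> real"
  assumes bm: "brownian_motion M F B"

sublocale brownian \<subseteq> prob_space M
  using bm by (simp add: brownian_motion_def)

context brownian
begin

lemma filtration_facts: "space (F t) = space M" "sets (F t) \<subseteq> events" "s \<le> t \<Longrightarrow> sets (F s) \<subseteq> sets (F t)"
  using bm unfolding brownian_motion_def filtration_of_def
  by (auto dest: filtration.space_F filtration.sets_F_mono)

lemma measurable_F_M: "X \<in> measurable (F t) N \<Longrightarrow> X \<in> measurable M N"
  using filtration_facts by (intro measurable_from_subalg[of M "F t"]) (auto simp: subalgebra_def)

lemma measurable_F_mono: "X \<in> measurable (F s) N \<Longrightarrow> s \<le> t \<Longrightarrow> X \<in> measurable (F t) N"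
  using filtration_facts by (intro measurable_from_subalg[of "F t" "F s"]) (auto simp: subalgebra_def)

lemma B_adapted: "0 \<le> t \<Longrightarrow> B t \<in> borel_measurable (F t)"
  using bm by (auto simp: brownian_motion_def)

lemma B_measurable: "0 \<le> t \<Longrightarrow> B t \<in> borel_measurable M"
  by (rule measurable_F_M[OF B_adapted])

lemma B_continuous: "AE \<omega> in M. continuous_on {0..} (\<lambda>t. B t \<omega>)"
  using bm by (auto simp: brownian_motion_def)

context
  fixes s t :: real
  assumes st: "0 \<le> s" "s < t"
begin

lemma increment_distributed: "distributed M lborel (\<lambda>\<omega>. B t \<omega> - B s \<omega>) (normal_density 0 (sqrt (t - s)))"
  using bm st by (auto simp: brownian_motion_def)

lemma increment_measurable: "(\<lambda>\<omega>. B t \<omega> - B s \<omega>) \<in> borel_measurable M"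
  using B_measurable[of s] B_measurable[of t] st by simp

lemma increment_moments:
  shows "integrable M (\<lambda>\<omega>. (B t \<omega> - B s \<omega>) ^ k)"
    and "expectation (\<lambda>\<omega>. B t \<omega> - B s \<omega>) = 0"
    and "expectation (\<lambda>\<omega>. (B t \<omega> - B s \<omega>)\<^sup>2) = t - s"
    and "expectation (\<lambda>\<omega>. (B t \<omega> - B s \<omega>) ^ 4) = 3 * (t - s)\<^sup>2"
proof -
  have sg: "0 < sqrt (t - s)" using st by simp
  show int: "integrable M (\<lambda>\<omega>. (B t \<omega> - B s \<omega>) ^ k)" for k
    using distributed_integrable[OF increment_distributed, of "\<lambda>x. x ^ k"] integrable_normal_moment[OF sg, of 0 k]
    by simp
  show "expectation (\<lambda>\<omega>. B t \<omega> - B s \<omega>) = 0"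
    by (rule normal_distributed_expectation[OF sg increment_distributed])
  show "expectation (\<lambda>\<omega>. (B t \<omega> - B s \<omega>)\<^sup>2) = t - s"
    using distributed_integral[OF increment_distributed, of "\<lambda>x. x\<^sup>2"] integral_normal_moment_even[OF sg, of 0 1] st
    by simp
  show "expectation (\<lambda>\<omega>. (B t \<omega> - B s \<omega>) ^ 4) = 3 * (t - s)\<^sup>2"
    using distributed_integral[OF increment_distributed, of "\<lambda>x. x ^ 4"] integral_normal_moment_even[OF sg, of 0 2] st
    by (simp add: fact_numeral power_divide)
qed

text \<open>The second and fourth moments combine to \<open>(3 - 2 + 1) * (t - s)\<^sup>2\<close>.
  Being quadratic in the length, these variances sum over short steps to something of the order of
  the mesh.\<close>

lemma increment_fourth_central:
  shows "integrable M (\<lambda>\<omega>. ((B t \<omega> - B s \<omega>)\<^sup>2 - (t - s))\<^sup>2)"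
    and "expectation (\<lambda>\<omega>. ((B t \<omega> - B s \<omega>)\<^sup>2 - (t - s))\<^sup>2) = 2 * (t - s)\<^sup>2"
proof -
  have eq: "((B t \<omega> - B s \<omega>)\<^sup>2 - (t - s))\<^sup>2 = (B t \<omega> - B s \<omega>) ^ 4 - 2 * (t - s) * (B t \<omega> - B s \<omega>)\<^sup>2 + (t - s)\<^sup>2" for \<omega>
    by (simp add: power2_eq_square power4_eq_xxxx algebra_simps)
  show "integrable M (\<lambda>\<omega>. ((B t \<omega> - B s \<omega>)\<^sup>2 - (t - s))\<^sup>2)"
    unfolding eq using increment_moments(1) by simp
  have "expectation (\<lambda>\<omega>. ((B t \<omega> - B s \<omega>)\<^sup>2 - (t - s))\<^sup>2)
     = expectation (\<lambda>\<omega>. (B t \<omega> - B s \<omega>) ^ 4) - 2 * (t - s) * expectation (\<lambda>\<omega>. (B t \<omega> - B s \<omega>)\<^sup>2) + (t - s)\<^sup>2"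
    unfolding eq using increment_moments(1) by (simp add: prob_space)
  thus "expectation (\<lambda>\<omega>. ((B t \<omega> - B s \<omega>)\<^sup>2 - (t - s))\<^sup>2) = 2 * (t - s)\<^sup>2"
    unfolding increment_moments by (simp add: power2_eq_square algebra_simps)
qed

lemma increment_indep:
  fixes X :: "'a \<Rightarrow> real" and \<psi> :: "real \<Rightarrow> real"
  assumes X: "X \<in> borel_measurable (F s)" and \<psi>: "\<psi> \<in> borel_measurable borel"
  shows "indep_var borel X borel (\<lambda>\<omega>. \<psi> (B t \<omega> - B s \<omega>))"
proof -
  let ?D = "\<lambda>\<omega>. B t \<omega> - B s \<omega>"
  \<comment> \<open>The preimages of Borel sets already form a sigma-algebra, so independence, given
    for events, need not be extended from a generator.\<close>
  have vimage: "sigma_sets (space M) {Y -` A \<inter> space M | A. A \<in> sets borel} = {Y -` A \<inter> space M | A. A \<in> sets borel}"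
    for Y :: "'a \<Rightarrow> real"
    using sets_vimage_algebra[of "space M" Y borel] sets_vimage_algebra2[of Y "space M" borel] by simp
  have "indep_var borel X borel ?D"
    unfolding indep_var_eq vimage
  proof (intro conjI indep_setI)
    show Xm: "random_variable borel X" by (rule measurable_F_M[OF X])
    show "{X -` A \<inter> space M | A. A \<in> sets borel} \<subseteq> events" using measurable_sets[OF Xm] by auto
    show "{?D -` A \<inter> space M | A. A \<in> sets borel} \<subseteq> events" using measurable_sets[OF increment_measurable] by auto
    fix a d assume "a \<in> {X -` A \<inter> space M | A. A \<in> sets borel}" "d \<in> {?D -` A \<inter> space M | A. A \<in> sets borel}"
    then obtain A C where AC: "A \<in> sets borel" "C \<in> sets borel" "a = X -` A \<inter> space M" "d = ?D -` C \<inter> space M" by auto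
    have "a \<in> sets (F s)" using measurable_sets[OF X AC(1)] AC(3) filtration_facts(1) by simp
    thus "prob (a \<inter> d) = prob a * prob d"
      using bm st AC unfolding brownian_motion_def by blast
  qed (rule increment_measurable)
  hence "indep_var borel (id \<circ> X) borel (\<psi> \<circ> ?D)" by (rule indep_var_compose) (use \<psi> in auto)
  thus ?thesis by (simp add: comp_def id_def)
qed

end

text \<open>Orthogonality of the martingale differences: the mixed terms vanish because each
  \<open>\<psi> k\<close> of an increment is centred and independent of the past.\<close>

lemma martingale_sum_L2:
  fixes r :: "nat \<Rightarrow> real" and c :: "nat \<Rightarrow> 'a \<Rightarrow> real" and \<psi> :: "nat \<Rightarrow> real \<Rightarrow> real" and v :: "nat \<Rightarrow> real"
  assumes r: "\<And>k. k < m \<Longrightarrow> 0 \<le> r k \<and> r k < r (Suc k)"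
    and c: "\<And>k. k < m \<Longrightarrow> c k \<in> borel_measurable (F (r k))" "\<And>k \<omega>. k < m \<Longrightarrow> \<bar>c k \<omega>\<bar> \<le> C"
    and \<psi>: "\<And>k. \<psi> k \<in> borel_measurable borel"
    and int: "\<And>k. k < m \<Longrightarrow> integrable M (\<lambda>\<omega>. (\<psi> k (B (r (Suc k)) \<omega> - B (r k) \<omega>))\<^sup>2)"
    and zero: "\<And>k. k < m \<Longrightarrow> expectation (\<lambda>\<omega>. \<psi> k (B (r (Suc k)) \<omega> - B (r k) \<omega>)) = 0"
    and v: "\<And>k. k < m \<Longrightarrow> expectation (\<lambda>\<omega>. (\<psi> k (B (r (Suc k)) \<omega> - B (r k) \<omega>))\<^sup>2) \<le> v k"
  shows "(\<lambda>\<omega>. \<Sum>k<m. c k \<omega> * \<psi> k (B (r (Suc k)) \<omega> - B (r k) \<omega>)) \<in> borel_measurable M"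
    and "integrable M (\<lambda>\<omega>. (\<Sum>k<m. c k \<omega> * \<psi> k (B (r (Suc k)) \<omega> - B (r k) \<omega>))\<^sup>2)"
    and "expectation (\<lambda>\<omega>. (\<Sum>k<m. c k \<omega> * \<psi> k (B (r (Suc k)) \<omega> - B (r k) \<omega>))\<^sup>2) \<le> C\<^sup>2 * (\<Sum>k<m. v k)"
proof -
  define Z where "Z k \<omega> = \<psi> k (B (r (Suc k)) \<omega> - B (r k) \<omega>)" for k \<omega>
  define S where "S j \<omega> = (\<Sum>k<j. c k \<omega> * Z k \<omega>)" for j \<omega>
  have mono: "r i \<le> r j" if "i \<le> j" "j \<le> m" for i j
    using that
  proof (induction j rule: dec_induct)
    case (step n)
    thus ?case using r[of n] by simp
  qed simp
  have Z_F: "Z k \<in> borel_measurable (F (r (Suc k)))" if "k < m" for k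
  proof -
    have [measurable]: "B (r (Suc k)) \<in> borel_measurable (F (r (Suc k)))" "B (r k) \<in> borel_measurable (F (r (Suc k)))"
      using r[OF that] B_adapted measurable_F_mono[of "B (r k)" "r k" borel "r (Suc k)"] by (auto simp: less_imp_le)
    have [measurable]: "\<psi> k \<in> borel_measurable borel" by (rule \<psi>)
    show ?thesis unfolding Z_def by measurable
  qed
  \<comment> \<open>The sum up to \<open>j\<close> uses increments that end by time
    \<open>r j\<close>, and the next increment starts there.\<close>
  have S_F: "S j \<in> borel_measurable (F (r j))" if "j \<le> m" for j
    unfolding S_def
  proof (intro borel_measurable_sum borel_measurable_times)
    fix k assume "k \<in> {..<j}"
    hence k: "k < j" "k < m" using that by auto
    show "c k \<in> borel_measurable (F (r j))"
      by (rule measurable_F_mono[OF c(1)[OF k(2)]]) (use mono k that in auto)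
    show "Z k \<in> borel_measurable (F (r j))"
      by (rule measurable_F_mono[OF Z_F[OF k(2)]]) (use mono k that in auto)
  qed
  have S_M: "S j \<in> borel_measurable M" if "j \<le> m" for j by (rule measurable_F_M[OF S_F[OF that]])
  have main: "integrable M (\<lambda>\<omega>. (S j \<omega>)\<^sup>2) \<and> expectation (\<lambda>\<omega>. (S j \<omega>)\<^sup>2) \<le> C\<^sup>2 * (\<Sum>k<j. v k)" if "j \<le> m" for j
    using that
  proof (induction j)
    case (Suc j)
    hence j: "j < m" and IH: "integrable M (\<lambda>\<omega>. (S j \<omega>)\<^sup>2)" "expectation (\<lambda>\<omega>. (S j \<omega>)\<^sup>2) \<le> C\<^sup>2 * (\<Sum>k<j. v k)" by auto
    have [measurable]: "S j \<in> borel_measurable M" "c j \<in> borel_measurable M" "Z j \<in> borel_measurable M"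
      using S_M[of j] measurable_F_M[OF c(1)[OF j]] measurable_F_M[OF Z_F[OF j]] j by auto
    have iZ2: "integrable M (\<lambda>\<omega>. (Z j \<omega>)\<^sup>2)" using int[OF j] by (simp add: Z_def)
    have iZ: "integrable M (Z j)" by (rule square_integrable_imp_integrable[OF _ iZ2]) simp
    have c2: "(c j \<omega>)\<^sup>2 \<le> C\<^sup>2" for \<omega>
      using c(2)[OF j, of \<omega>] by (metis abs_ge_zero power2_abs power_mono)
    have iSc2: "integrable M (\<lambda>\<omega>. (S j \<omega> * c j \<omega>)\<^sup>2)"
    proof (rule Bochner_Integration.integrable_bound)
      show "integrable M (\<lambda>\<omega>. C\<^sup>2 * (S j \<omega>)\<^sup>2)" using IH by simp
      show "AE \<omega> in M. norm ((S j \<omega> * c j \<omega>)\<^sup>2) \<le> norm (C\<^sup>2 * (S j \<omega>)\<^sup>2)"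
        using mult_right_mono[OF c2, of "(S j _)\<^sup>2"] by (simp add: power_mult_distrib mult.commute)
    qed measurable
    have iSc: "integrable M (\<lambda>\<omega>. S j \<omega> * c j \<omega>)"
      by (rule square_integrable_imp_integrable[OF _ iSc2]) simp
    have icZ2: "integrable M (\<lambda>\<omega>. (c j \<omega> * Z j \<omega>)\<^sup>2)"
    proof (rule Bochner_Integration.integrable_bound)
      show "integrable M (\<lambda>\<omega>. C\<^sup>2 * (Z j \<omega>)\<^sup>2)" using iZ2 by simp
      show "AE \<omega> in M. norm ((c j \<omega> * Z j \<omega>)\<^sup>2) \<le> norm (C\<^sup>2 * (Z j \<omega>)\<^sup>2)"
        using c2 by (auto simp: power_mult_distrib intro!: mult_right_mono)
    qed measurable
    have "(\<lambda>\<omega>. S j \<omega> * c j \<omega>) \<in> borel_measurable (F (r j))"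
      using S_F[of j] c(1)[OF j] j by (intro borel_measurable_times) auto
    hence indep: "indep_var borel (\<lambda>\<omega>. S j \<omega> * c j \<omega>) borel (Z j)"
      using increment_indep[of "r j" "r (Suc j)" _ "\<psi> j"] r[OF j] \<psi> by (auto simp: Z_def[abs_def])
    have iScZ: "integrable M (\<lambda>\<omega>. S j \<omega> * c j \<omega> * Z j \<omega>)" by (rule indep_var_integrable[OF indep iSc iZ])
    have EScZ: "expectation (\<lambda>\<omega>. S j \<omega> * c j \<omega> * Z j \<omega>) = 0"
      using indep_var_lebesgue_integral[OF indep iSc iZ] zero[OF j] by (simp add: Z_def)
    have eq: "(S (Suc j) \<omega>)\<^sup>2 = (S j \<omega>)\<^sup>2 + 2 * (S j \<omega> * c j \<omega> * Z j \<omega>) + (c j \<omega> * Z j \<omega>)\<^sup>2" for \<omega>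
      by (simp add: S_def power2_eq_square algebra_simps)
    have "expectation (\<lambda>\<omega>. (S (Suc j) \<omega>)\<^sup>2) = expectation (\<lambda>\<omega>. (S j \<omega>)\<^sup>2) + expectation (\<lambda>\<omega>. (c j \<omega> * Z j \<omega>)\<^sup>2)"
      unfolding eq using IH(1) iScZ icZ2 EScZ by simp
    also have "expectation (\<lambda>\<omega>. (c j \<omega> * Z j \<omega>)\<^sup>2) \<le> expectation (\<lambda>\<omega>. C\<^sup>2 * (Z j \<omega>)\<^sup>2)"
      using c2 iZ2 by (intro integral_mono icZ2) (auto simp: power_mult_distrib intro!: mult_right_mono)
    also have "\<dots> \<le> C\<^sup>2 * v j" using v[OF j] by (simp add: Z_def mult_left_mono)
    finally have "expectation (\<lambda>\<omega>. (S (Suc j) \<omega>)\<^sup>2) \<le> C\<^sup>2 * (\<Sum>k<Suc j. v k)"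
      using IH(2) by (simp add: algebra_simps)
    moreover have "integrable M (\<lambda>\<omega>. (S (Suc j) \<omega>)\<^sup>2)"
      unfolding eq using IH(1) iScZ icZ2 by simp
    ultimately show ?case by simp
  qed (simp add: S_def)
  show "(\<lambda>\<omega>. \<Sum>k<m. c k \<omega> * \<psi> k (B (r (Suc k)) \<omega> - B (r k) \<omega>)) \<in> borel_measurable M"
    using S_M[of m] by (simp add: S_def[abs_def] Z_def)
  show "integrable M (\<lambda>\<omega>. (\<Sum>k<m. c k \<omega> * \<psi> k (B (r (Suc k)) \<omega> - B (r k) \<omega>))\<^sup>2)"
    "expectation (\<lambda>\<omega>. (\<Sum>k<m. c k \<omega> * \<psi> k (B (r (Suc k)) \<omega> - B (r k) \<omega>))\<^sup>2) \<le> C\<^sup>2 * (\<Sum>k<m. v k)"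
    using main[of m] by (simp_all add: S_def[abs_def] Z_def)
qed

end

section \<open>The Ito formula\<close>

text \<open>Decreasing mesh bounds make the sets \<open>long_gaps n\<close> increase, which monotone
  convergence for the squared jumps relies on; the partitions themselves are not assumed to be
  nested.\<close>

locale ts_ito = brownian M F B + ts_ito_function T t1 t2 \<delta> m r f fd fx fxx fdx
  for M :: "'a measure" and F :: "real \<Rightarrow> 'a measure" and B :: "real \<Rightarrow> 'a \<Rightarrow> real"
    and T :: "real set" and t1 t2 :: real and \<delta> :: "nat \<Rightarrow> real" and m :: "nat \<Rightarrow> nat" and r :: "nat \<Rightarrow> nat \<Rightarrow> real"
    and f fd fx fxx fdx :: "real \<Rightarrow> real \<Rightarrow> real" +
  assumes \<delta>_dec: "decseq \<delta>"
begin

abbreviation "sample \<omega> \<equiv> (\<lambda>t. B t \<omega>)"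

lemma path_continuous: "AE \<omega> in M. continuous_on {t1..t2} (sample \<omega>)"
  using B_continuous by eventually_elim (erule continuous_on_subset, use t1_nonneg in auto)

lemma B_M: "t \<in> T \<Longrightarrow> t1 \<le> t \<Longrightarrow> B t \<in> borel_measurable M"
  using B_measurable[of t] t1_nonneg by simp

lemma B_part_measurable: "k < m n \<Longrightarrow> B (r n k) \<in> borel_measurable M" "k < m n \<Longrightarrow> B (r n (Suc k)) \<in> borel_measurable M"
  using B_M part_in by auto

lemma space_measurable:
  shows "t \<in> T \<Longrightarrow> f t \<in> borel_measurable borel" "t \<in> T \<Longrightarrow> fx t \<in> borel_measurable borel"
    "t \<in> T \<Longrightarrow> fxx t \<in> borel_measurable borel"
proof -
  assume t: "t \<in> T"
  show "f t \<in> borel_measurable borel"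
    by (rule borel_measurable_continuous_onI) (intro DERIV_continuous_on[OF has_field_derivative_at_within[OF px1[OF t]]])
  show "fx t \<in> borel_measurable borel"
    by (rule borel_measurable_continuous_onI) (intro DERIV_continuous_on[OF has_field_derivative_at_within[OF px2[OF t]]])
  have "continuous_on UNIV ((\<lambda>(t, x). fxx t x) \<circ> (\<lambda>x. (t, x)))"
    using t by (intro continuous_on_compose continuous_intros continuous_on_subset[OF c_fxx]) auto
  hence "continuous_on UNIV (fxx t)" by (simp add: comp_def)
  thus "fxx t \<in> borel_measurable borel" by (rule borel_measurable_continuous_onI)
qed

lemma step_measurable [measurable]:
  assumes "k < m n"
  shows "(\<lambda>\<omega>. B (r n k) \<omega>) \<in> borel_measurable M" "(\<lambda>\<omega>. B (r n (Suc k)) \<omega>) \<in> borel_measurable M"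
    "f (r n k) \<in> borel_measurable borel" "fx (r n k) \<in> borel_measurable borel" "fxx (r n k) \<in> borel_measurable borel"
    "f (r n (Suc k)) \<in> borel_measurable borel" "fx (r n (Suc k)) \<in> borel_measurable borel"
  using assms B_part_measurable space_measurable part_in by auto

lemma sums_measurable [measurable]:
  shows "(\<lambda>\<omega>. mart_sum n (sample \<omega>)) \<in> borel_measurable M"
    and "(\<lambda>\<omega>. quad_sum n (sample \<omega>)) \<in> borel_measurable M"
    and "(\<lambda>\<omega>. taylor_sum n (sample \<omega>)) \<in> borel_measurable M"
    and "(\<lambda>\<omega>. time_sum n (sample \<omega>)) \<in> borel_measurable M"
    and "(\<lambda>\<omega>. second_sum n (sample \<omega>)) \<in> borel_measurable M"
proof -
  have meas: "(\<lambda>\<omega>. \<Sum>k<m n. h k \<omega>) \<in> borel_measurable M" if "\<And>k. k < m n \<Longrightarrow> h k \<in> borel_measurable M"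
    for h :: "nat \<Rightarrow> 'a \<Rightarrow> real"
    using that by (intro borel_measurable_sum) auto
  note [measurable] = step_measurable
  show "(\<lambda>\<omega>. mart_sum n (sample \<omega>)) \<in> borel_measurable M"
    unfolding mart_sum_def by (rule meas) measurable
  show "(\<lambda>\<omega>. quad_sum n (sample \<omega>)) \<in> borel_measurable M"
    unfolding quad_sum_def by (rule meas) measurable
  show "(\<lambda>\<omega>. taylor_sum n (sample \<omega>)) \<in> borel_measurable M"
    unfolding taylor_sum_def by (rule meas) measurable
  show "(\<lambda>\<omega>. time_sum n (sample \<omega>)) \<in> borel_measurable M"
    unfolding time_sum_def by (rule meas) measurable
  show "(\<lambda>\<omega>. second_sum n (sample \<omega>)) \<in> borel_measurable M"
    unfolding second_sum_def by (rule meas) measurable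
qed

lemma gap_facts:
  assumes "a \<in> gaps"
  shows "a \<in> T" "\<sigma> a \<in> T" "0 \<le> a" "a < \<sigma> a" "t1 \<le> a" "t1 \<le> \<sigma> a"
proof -
  have a: "a \<in> T" "a < t2" "t1 \<le> a" "a < \<sigma> a" using assms by (auto simp: ts_gaps_in_def)
  thus "a \<in> T" "\<sigma> a \<in> T" "0 \<le> a" "a < \<sigma> a" "t1 \<le> a" "t1 \<le> \<sigma> a"
    using ts_sigma_props(1)[OF T _ t2T, of a] t1_nonneg by auto
qed

lemma gap_sum_measurable [measurable]: "(\<lambda>\<omega>. \<Sum>a\<in>long_gaps n. gap_term (sample \<omega>) a) \<in> borel_measurable M"
proof (rule borel_measurable_sum)
  fix a assume "a \<in> long_gaps n"
  hence "a \<in> gaps" by (simp add: long_gaps_def)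
  note a = gap_facts[OF this]
  note [measurable] = B_M[OF a(1,5)] B_M[OF a(2,6)] space_measurable[OF a(1)] space_measurable[OF a(2)]
  show "(\<lambda>\<omega>. gap_term (sample \<omega>) a) \<in> borel_measurable M" unfolding gap_term_def by measurable
qed

section \<open>Truncation and the sums that vanish in probability\<close>

definition "exceed K = {\<omega>\<in>space M. \<exists>n. \<exists>k<m n. \<bar>B (r n k) \<omega>\<bar> > real K}"

text \<open>Only partition points are tested, countably many for all \<open>n\<close> together, so
  measurability is immediate although paths are continuous only almost surely. One event serves all
  \<open>n\<close>, as the localization demands.\<close>

lemma exceed_events: "exceed K \<in> events"
proof -
  have "exceed K = (\<Union>n. \<Union>k\<in>{..<m n}. {\<omega>\<in>space M. \<bar>B (r n k) \<omega>\<bar> > real K})"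
    by (auto simp: exceed_def)
  also have "\<dots> \<in> events"
    by (intro sets.countable_UN sets.finite_UN image_subsetI) (use step_measurable in \<open>auto intro!: borel_measurable_abs borel_measurable_less borel_measurable_const\<close>)
  finally show ?thesis .
qed

lemma exceed_tendsto: "(\<lambda>K. prob (exceed K)) \<longlonglongrightarrow> 0"
proof (rule prob_tendsto_zero[OF exceed_events])
  show "AE \<omega> in M. \<forall>\<^sub>F K in sequentially. \<omega> \<notin> exceed K"
    using path_continuous
  proof eventually_elim
    case (elim \<omega>)
    obtain C where C: "\<And>t. t1 \<le> t \<Longrightarrow> t \<le> t2 \<Longrightarrow> \<bar>sample \<omega> t\<bar> \<le> C" using bounded_path[OF elim] by metis
    obtain K0 :: nat where K0: "C \<le> real K0" using real_arch_simple by blast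
    show ?case unfolding eventually_sequentially
    proof (intro exI[of _ K0] allI impI notI)
      fix K assume "K \<ge> K0" "\<omega> \<in> exceed K"
      then obtain n k where "k < m n" "\<bar>B (r n k) \<omega>\<bar> > real K" by (auto simp: exceed_def)
      with C[of "r n k"] part_in[of k n] K0 \<open>K \<ge> K0\<close> show False by simp
    qed
  qed
qed

text \<open>Truncation at the left endpoint keeps the integrands adapted and changes nothing
  outside \<open>exceed K\<close>.\<close>

definition "trunc K n k \<omega> = (indicator {-real K..real K} (B (r n k) \<omega>) :: real)"

lemma trunc_adapted:
  assumes k: "k < m n" and h: "h \<in> borel_measurable borel"
  shows "(\<lambda>\<omega>. trunc K n k \<omega> * h (B (r n k) \<omega>)) \<in> borel_measurable (F (r n k))"
proof -
  have [measurable]: "B (r n k) \<in> borel_measurable (F (r n k))" "h \<in> borel_measurable borel"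
    using B_adapted part_in[OF k] h by auto
  show ?thesis unfolding trunc_def by measurable
qed

lemma trunc_bound:
  fixes h :: "real \<Rightarrow> real"
  assumes "\<And>x. \<bar>x\<bar> \<le> real K \<Longrightarrow> \<bar>h x\<bar> \<le> C" "0 \<le> C"
  shows "\<bar>trunc K n k \<omega> * h (B (r n k) \<omega>)\<bar> \<le> C"
  using assms by (auto simp: trunc_def indicator_def abs_le_iff)

lemma trunc_eq:
  assumes "\<omega> \<in> space M" "\<omega> \<notin> exceed K" "k < m n"
  shows "trunc K n k \<omega> = 1"
proof -
  have "\<bar>B (r n k) \<omega>\<bar> \<le> real K" using assms by (force simp: exceed_def)
  thus ?thesis by (auto simp: trunc_def indicator_def abs_le_iff)
qed

text \<open>For \<open>\<bar>x\<bar> \<le> K\<close> the coefficient is below \<eta> once the mesh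
  bound is small, by uniform continuity of \<open>fx\<close>. Orthogonality then bounds the second
  moment of the truncated sum by \<open>\<eta>\<^sup>2 * (t2 - t1)\<close>.\<close>

lemma mart_sum_conv: "conv_in_prob M (\<lambda>n \<omega>. mart_sum n (sample \<omega>)) (\<lambda>_. 0)"
proof -
  \<comment> \<open>The restriction to short steps goes into the coefficient, since over a long gap
    \<open>fx\<close> may change by a fixed amount.\<close>
  define c where "c n k x = (if small n k then fx (r n (Suc k)) x - fx (r n k) x else 0)" for n k x
  define U' where "U' K n \<omega> = (\<Sum>k<m n. (trunc K n k \<omega> * c n k (B (r n k) \<omega>)) * (B (r n (Suc k)) \<omega> - B (r n k) \<omega>))" for K n \<omega>
  have c_meas: "c n k \<in> borel_measurable borel" if "k < m n" for n k
  proof -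
    note [measurable] = step_measurable[OF that]
    show ?thesis unfolding c_def by measurable
  qed
  have U'_meas: "U' K n \<in> borel_measurable M" for K n
    unfolding U'_def
  proof (rule borel_measurable_sum)
    fix k assume "k \<in> {..<m n}"
    hence k: "k < m n" by simp
    note [measurable] = measurable_F_M[OF trunc_adapted[OF k c_meas[OF k]]] B_part_measurable[OF k]
    show "(\<lambda>\<omega>. (trunc K n k \<omega> * c n k (B (r n k) \<omega>)) * (B (r n (Suc k)) \<omega> - B (r n k) \<omega>)) \<in> borel_measurable M"
      by measurable
  qed
  show ?thesis
  proof (rule conv_in_prob_localized[where U' = U' and V = exceed])
    fix K n \<omega> assume "\<omega> \<in> space M" "\<omega> \<notin> exceed K"
    thus "mart_sum n (sample \<omega>) = U' K n \<omega>"
      unfolding mart_sum_def U'_def by (intro sum.cong) (auto simp: trunc_eq c_def)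
  next
    fix K :: nat and e :: real assume e: "e > 0"
    define \<eta> where "\<eta> = sqrt (e / (t2 - t1 + 1))"
    have \<eta>: "\<eta> > 0" using e t12 by (simp add: \<eta>_def)
    have "\<eta>\<^sup>2 * (t2 - t1) \<le> \<eta>\<^sup>2 * (t2 - t1 + 1)" by (intro mult_left_mono) auto
    also have "\<dots> = e" using e t12 by (simp add: \<eta>_def)
    finally have \<eta>e: "\<eta>\<^sup>2 * (t2 - t1) \<le> e" .
    obtain d where d: "d > 0"
      "\<And>t t' x x'. \<lbrakk>t \<in> T; t' \<in> T; t1 \<le> t; t \<le> t2; t1 \<le> t'; t' \<le> t2; \<bar>x\<bar> \<le> real K; \<bar>x'\<bar> \<le> real K; \<bar>t - t'\<bar> < d; \<bar>x - x'\<bar> < d\<rbrakk>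
        \<Longrightarrow> \<bar>fx t x - fx t' x'\<bar> < \<eta>"
      using uniformly_continuous_strip[OF T c_fx \<eta>, of t1 t2 "real K"] by metis
    show "\<forall>\<^sub>F n in sequentially. integrable M (\<lambda>\<omega>. (U' K n \<omega>)\<^sup>2) \<and> expectation (\<lambda>\<omega>. (U' K n \<omega>)\<^sup>2) \<le> e"
      using eventually_\<delta>_less[OF d(1)]
    proof eventually_elim
      case (elim n)
      have cb: "\<bar>c n k x\<bar> \<le> \<eta>" if "k < m n" "\<bar>x\<bar> \<le> real K" for k x
      proof (cases "small n k")
        case True
        have "\<bar>fx (r n (Suc k)) x - fx (r n k) x\<bar> < \<eta>"
          by (rule d(2)) (use True part_in[OF that(1)] elim that d(1) in \<open>auto simp: small_def\<close>)
        thus ?thesis using True by (simp add: c_def)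
      qed (use \<eta> in \<open>simp add: c_def\<close>)
      have inc: "0 \<le> r n k \<and> r n k < r n (Suc k)" if "k < m n" for k using part_in[OF that] by simp
      have ad: "(\<lambda>\<omega>. trunc K n k \<omega> * c n k (B (r n k) \<omega>)) \<in> borel_measurable (F (r n k))" if "k < m n" for k
        by (rule trunc_adapted[OF that c_meas[OF that]])
      have bd: "\<bar>trunc K n k \<omega> * c n k (B (r n k) \<omega>)\<bar> \<le> \<eta>" if "k < m n" for k \<omega>
        by (rule trunc_bound[OF cb[OF that] less_imp_le[OF \<eta>]])
      have int: "integrable M (\<lambda>\<omega>. (B (r n (Suc k)) \<omega> - B (r n k) \<omega>)\<^sup>2)"
        and zero: "expectation (\<lambda>\<omega>. B (r n (Suc k)) \<omega> - B (r n k) \<omega>) = 0"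
        and v: "expectation (\<lambda>\<omega>. (B (r n (Suc k)) \<omega> - B (r n k) \<omega>)\<^sup>2) \<le> r n (Suc k) - r n k" if "k < m n" for k
        using increment_moments inc[OF that] by auto
      note L2 = martingale_sum_L2[of "m n" "r n" "\<lambda>k \<omega>. trunc K n k \<omega> * c n k (B (r n k) \<omega>)" \<eta> "\<lambda>_ x. x"
          "\<lambda>k. r n (Suc k) - r n k"]
      have "integrable M (\<lambda>\<omega>. (U' K n \<omega>)\<^sup>2)"
        unfolding U'_def by (rule L2(2); (rule inc ad bd measurable_id int zero v)?)
      moreover have "expectation (\<lambda>\<omega>. (U' K n \<omega>)\<^sup>2) \<le> \<eta>\<^sup>2 * (\<Sum>k<m n. r n (Suc k) - r n k)"
        unfolding U'_def by (rule L2(3); (rule inc ad bd measurable_id int zero v)?)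
      ultimately show ?case using \<eta>e ts_partition_sum_lengths[OF part, of n] by simp
    qed
  qed (use U'_meas exceed_events exceed_tendsto in auto)
qed

text \<open>The truncated coefficients are merely bounded by some \<open>C\<close>. Smallness comes
  from the variance \<open>2 * (t - s)\<^sup>2\<close>, which on a short step is at most
  \<open>2 * \<delta> n * (t - s)\<close>.\<close>

lemma quad_sum_conv: "conv_in_prob M (\<lambda>n \<omega>. quad_sum n (sample \<omega>)) (\<lambda>_. 0)"
proof -
  define c where "c n k x = 1/2 * fxx (r n k) x" for n k x
  \<comment> \<open>The restriction to short steps goes into \<psi>, so that the variance bound
    \<open>v\<close> also holds on long steps, whose squared length \<open>\<delta> n\<close> does
    not control.\<close>
  define \<psi> where "\<psi> n k x = (if small n k then x\<^sup>2 - (r n (Suc k) - r n k) else 0)" for n k and x :: real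
  define U' where "U' K n \<omega> = (\<Sum>k<m n. (trunc K n k \<omega> * c n k (B (r n k) \<omega>)) * \<psi> n k (B (r n (Suc k)) \<omega> - B (r n k) \<omega>))" for K n \<omega>
  have c_meas: "c n k \<in> borel_measurable borel" if "k < m n" for n k
  proof -
    note [measurable] = step_measurable[OF that]
    show ?thesis unfolding c_def by measurable
  qed
  have \<psi>_meas: "\<psi> n k \<in> borel_measurable borel" for n k unfolding \<psi>_def by measurable
  have inc: "0 \<le> r n k \<and> r n k < r n (Suc k)" if "k < m n" for n k using part_in[OF that] by simp
  have int: "integrable M (\<lambda>\<omega>. (\<psi> n k (B (r n (Suc k)) \<omega> - B (r n k) \<omega>))\<^sup>2)" if "k < m n" for n k
    using increment_fourth_central(1) inc[OF that] by (cases "small n k") (auto simp: \<psi>_def)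
  have zero: "expectation (\<lambda>\<omega>. \<psi> n k (B (r n (Suc k)) \<omega> - B (r n k) \<omega>)) = 0" if "k < m n" for n k
    using increment_moments(1)[of "r n k" "r n (Suc k)" 2] increment_moments(3)[of "r n k" "r n (Suc k)"] inc[OF that]
    by (cases "small n k") (auto simp: \<psi>_def prob_space)
  have v: "expectation (\<lambda>\<omega>. (\<psi> n k (B (r n (Suc k)) \<omega> - B (r n k) \<omega>))\<^sup>2) \<le> 2 * \<delta> n * (r n (Suc k) - r n k)"
    if "k < m n" for n k
  proof (cases "small n k")
    case True
    have "(r n (Suc k) - r n k)\<^sup>2 \<le> \<delta> n * (r n (Suc k) - r n k)"
      unfolding power2_eq_square using True inc[OF that] by (intro mult_right_mono) (auto simp: small_def)
    thus ?thesis using increment_fourth_central(2) inc[OF that] True by (simp add: \<psi>_def)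
  qed (use inc[OF that] \<delta>_pos[of n] in \<open>simp add: \<psi>_def\<close>)
  have U'_meas: "U' K n \<in> borel_measurable M" for K n
    unfolding U'_def
  proof (rule borel_measurable_sum)
    fix k assume "k \<in> {..<m n}"
    hence k: "k < m n" by simp
    note [measurable] = measurable_F_M[OF trunc_adapted[OF k c_meas[OF k]]] B_part_measurable[OF k] \<psi>_meas
    show "(\<lambda>\<omega>. (trunc K n k \<omega> * c n k (B (r n k) \<omega>)) * \<psi> n k (B (r n (Suc k)) \<omega> - B (r n k) \<omega>)) \<in> borel_measurable M"
      by measurable
  qed
  show ?thesis
  proof (rule conv_in_prob_localized[where U' = U' and V = exceed])
    fix K n \<omega> assume "\<omega> \<in> space M" "\<omega> \<notin> exceed K"
    thus "quad_sum n (sample \<omega>) = U' K n \<omega>"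
      unfolding quad_sum_def U'_def by (intro sum.cong) (auto simp: trunc_eq c_def \<psi>_def)
  next
    fix K :: nat and e :: real assume e: "e > 0"
    obtain C where C: "C \<ge> 0" "\<And>t x. \<lbrakk>t \<in> T; t1 \<le> t; t \<le> t2; \<bar>x\<bar> \<le> real K\<rbrakk> \<Longrightarrow> \<bar>fxx t x\<bar> \<le> C"
      using bounded_strip[OF T c_fxx, of t1 t2 "real K"] by metis
    \<comment> \<open>For \<open>\<delta> n < d\<close> the second moment bound
      \<open>2 * C\<^sup>2 * \<delta> n * (t2 - t1)\<close> is at most \<open>e\<close>; the added
      1s exclude division by 0.\<close>
    define d where "d = e / (2 * (C\<^sup>2 + 1) * (t2 - t1 + 1))"
    have den: "0 < 2 * (C\<^sup>2 + 1) * (t2 - t1 + 1)" using t12 by (intro mult_pos_pos) (auto intro: add_nonneg_pos)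
    have d: "d > 0" using e den by (simp add: d_def)
    have cb: "\<bar>c n k x\<bar> \<le> C" if "k < m n" "\<bar>x\<bar> \<le> real K" for n k x
      using C(2)[of "r n k" x] part_in[OF that(1)] that(2) C(1) by (simp add: c_def)
    show "\<forall>\<^sub>F n in sequentially. integrable M (\<lambda>\<omega>. (U' K n \<omega>)\<^sup>2) \<and> expectation (\<lambda>\<omega>. (U' K n \<omega>)\<^sup>2) \<le> e"
      using eventually_\<delta>_less[OF d]
    proof eventually_elim
      case (elim n)
      have ad: "(\<lambda>\<omega>. trunc K n k \<omega> * c n k (B (r n k) \<omega>)) \<in> borel_measurable (F (r n k))" if "k < m n" for k
        by (rule trunc_adapted[OF that c_meas[OF that]])
      have bd: "\<bar>trunc K n k \<omega> * c n k (B (r n k) \<omega>)\<bar> \<le> C" if "k < m n" for k \<omega>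
        by (rule trunc_bound[OF cb[OF that] C(1)])
      note L2 = martingale_sum_L2[of "m n" "r n" "\<lambda>k \<omega>. trunc K n k \<omega> * c n k (B (r n k) \<omega>)" C "\<psi> n"
          "\<lambda>k. 2 * \<delta> n * (r n (Suc k) - r n k)"]
      have "expectation (\<lambda>\<omega>. (U' K n \<omega>)\<^sup>2) \<le> C\<^sup>2 * (\<Sum>k<m n. 2 * \<delta> n * (r n (Suc k) - r n k))"
        unfolding U'_def by (rule L2(3); (rule inc ad bd \<psi>_meas int zero v)?)
      also have "\<dots> = \<delta> n * (2 * C\<^sup>2 * (t2 - t1))" unfolding sum_steps by simp
      also have "\<dots> \<le> d * (2 * (C\<^sup>2 + 1) * (t2 - t1 + 1))"
        using elim d t12 by (intro mult_mono) (auto intro!: mult_nonneg_nonneg)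
      also have "\<dots> = e" unfolding d_def using den by (intro nonzero_eq_divide_eq[THEN iffD1]) auto
      finally have "expectation (\<lambda>\<omega>. (U' K n \<omega>)\<^sup>2) \<le> e" .
      moreover have "integrable M (\<lambda>\<omega>. (U' K n \<omega>)\<^sup>2)" unfolding U'_def by (rule L2(2); (rule inc ad bd \<psi>_meas int zero v)?)
      ultimately show ?case by simp
    qed
  qed (use U'_meas exceed_events exceed_tendsto in auto)
qed

text \<open>The dominating \<open>sq_sum\<close> has expectation \<open>t2 - t1\<close> for every
  partition, however fine.\<close>

lemma taylor_sum_conv: "conv_in_prob M (\<lambda>n \<omega>. taylor_sum n (sample \<omega>)) (\<lambda>_. 0)"
proof (rule conv_in_prob_dominated[where Q = "\<lambda>n \<omega>. sq_sum n (sample \<omega>)" and c = "t2 - t1"])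
  have inc: "0 \<le> r n k" "r n k < r n (Suc k)" if "k < m n" for n k using part_in[OF that] by auto
  show "integrable M (\<lambda>\<omega>. sq_sum n (sample \<omega>))" for n
    unfolding sq_sum_def using increment_moments(1) inc by (intro Bochner_Integration.integrable_sum) auto
  have "expectation (\<lambda>\<omega>. sq_sum n (sample \<omega>)) = (\<Sum>k<m n. r n (Suc k) - r n k)" for n
    unfolding sq_sum_def using increment_moments(1,3) inc
    by (subst Bochner_Integration.integral_sum) (auto intro!: sum.cong)
  thus "expectation (\<lambda>\<omega>. sq_sum n (sample \<omega>)) \<le> t2 - t1" for n
    using ts_partition_sum_lengths[OF part] by simp
  show "AE \<omega> in M. \<forall>\<^sub>F n in sequentially. \<bar>taylor_sum n (sample \<omega>)\<bar> \<le> \<eta> * sq_sum n (sample \<omega>)" if "\<eta> > 0" for \<eta>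
    using path_continuous by eventually_elim (rule taylor_sum_bound[OF _ that])
qed (auto simp: sq_sum_def intro: sum_nonneg)

text \<open>The sums increase with \<open>n\<close>, and their expectations are total gap lengths,
  at most \<open>t2 - t1\<close>. By monotone convergence the supremum has finite expectation, so it
  is finite almost surely and provides the bound for absolute convergence of the jump
  series.\<close>

lemma gap_squares_bounded:
  "AE \<omega> in M. \<exists>c. \<forall>n. (\<Sum>a\<in>long_gaps n. (B (\<sigma> a) \<omega> - B a \<omega>)\<^sup>2) \<le> c"
proof -
  define Q where "Q n \<omega> = (\<Sum>a\<in>long_gaps n. (B (\<sigma> a) \<omega> - B a \<omega>)\<^sup>2)" for n \<omega>
  have g: "0 \<le> a" "a < \<sigma> a" if "a \<in> long_gaps n" for a n
    using gap_facts[of a] that by (auto simp: long_gaps_def)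
  have int: "integrable M (Q n)" for n
    unfolding Q_def using increment_moments(1) g by (intro Bochner_Integration.integrable_sum) auto
  have [measurable]: "Q n \<in> borel_measurable M" for n using int by simp
  have "expectation (Q n) = (\<Sum>a\<in>long_gaps n. \<sigma> a - a)" for n
    unfolding Q_def using increment_moments(1,3) g
    by (subst Bochner_Integration.integral_sum) (auto intro!: sum.cong)
  also have "\<dots> n \<le> t2 - t1" for n
    by (rule sum_gap_lengths_le[OF T finite_long_gaps' _ t2T t12]) (auto simp: long_gaps_def)
  finally have EQ: "expectation (Q n) \<le> t2 - t1" for n .
  have nn: "0 \<le> Q n \<omega>" for n \<omega> by (simp add: Q_def sum_nonneg)
  have "long_gaps i \<subseteq> long_gaps j" if "i \<le> j" for i j
    using decseqD[OF \<delta>_dec that] by (auto simp: long_gaps_def)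
  hence mono: "Q i \<omega> \<le> Q j \<omega>" if "i \<le> j" for i j \<omega>
    unfolding Q_def using that by (intro sum_mono2 finite_long_gaps') auto
  have "(\<integral>\<^sup>+\<omega>. (SUP n. ennreal (Q n \<omega>)) \<partial>M) = (SUP n. \<integral>\<^sup>+\<omega>. ennreal (Q n \<omega>) \<partial>M)"
    by (rule nn_integral_monotone_convergence_SUP) (auto simp: incseq_def le_fun_def mono ennreal_leI)
  also have "\<dots> \<le> ennreal (t2 - t1)"
    using EQ nn_integral_eq_integral[OF int] nn by (intro SUP_least) (auto intro!: ennreal_leI)
  finally have "(\<integral>\<^sup>+\<omega>. (SUP n. ennreal (Q n \<omega>)) \<partial>M) \<noteq> \<infinity>" by (auto simp: top_unique)
  hence "AE \<omega> in M. (SUP n. ennreal (Q n \<omega>)) \<noteq> \<infinity>" by (intro nn_integral_PInf_AE) measurable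
  thus ?thesis
  proof eventually_elim
    case (elim \<omega>)
    show ?case
    proof (intro exI[of _ "enn2real (SUP n. ennreal (Q n \<omega>))"] allI)
      fix n
      have "ennreal (Q n \<omega>) \<le> (SUP n. ennreal (Q n \<omega>))" by (rule SUP_upper) simp
      also have "\<dots> = ennreal (enn2real (SUP n. ennreal (Q n \<omega>)))"
        using elim unfolding infinity_ennreal_def less_top by (rule ennreal_enn2real[symmetric])
      finally have "Q n \<omega> \<le> enn2real (SUP n. ennreal (Q n \<omega>))" using nn by (simp add: ennreal_le_iff)
      thus "(\<Sum>a\<in>long_gaps n. (B (\<sigma> a) \<omega> - B a \<omega>)\<^sup>2) \<le> enn2real (SUP n. ennreal (Q n \<omega>))" by (simp add: Q_def)
    qed
  qed
qed

text \<open>Solved for the Ito sum, the decomposition reads \<open>V n\<close> minus three sums that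
  vanish in probability. \<open>V n\<close> converges along almost every path, so the Ito sums
  converge in probability to the same limit. The explicit form \<open>L\<close> of this limit is the
  formula, rearranged.\<close>

lemma ito_formula:
  "\<exists>X. is_ito_integral M F B t1 t2 (\<lambda>s \<omega>. fx (ext s) (B (ext s) \<omega>)) X \<and>
     (AE \<omega> in M. (gap_term (sample \<omega>) has_sum
        (f t2 (B t2 \<omega>) - f t1 (B t1 \<omega>) - (LBINT s:{t1..t2}. fd (ext s) (B (ext s) \<omega>)) - X \<omega>
         - 1/2 * (LBINT s:{t1..t2}. fxx (ext s) (B (ext s) \<omega>)))) gaps)"
proof -
  define V where "V n \<omega> = f t2 (B t2 \<omega>) - f t1 (B t1 \<omega>) - (\<Sum>a\<in>long_gaps n. gap_term (sample \<omega>) a)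
    - time_sum n (sample \<omega>) - 1/2 * second_sum n (sample \<omega>)" for n \<omega>
  \<comment> \<open>As a limit of measurable functions \<open>X\<close> is measurable outright; the
    expression \<open>L\<close>, with its infinite sum and integrals, is shown to agree with it
    almost surely.\<close>
  define X where "X \<omega> = lim (\<lambda>n. V n \<omega>)" for \<omega>
  define L where "L \<omega> = f t2 (B t2 \<omega>) - f t1 (B t1 \<omega>) - infsum (gap_term (sample \<omega>)) gaps
    - (LBINT s:{t1..t2}. fd (ext s) (B (ext s) \<omega>)) - 1/2 * (LBINT s:{t1..t2}. fxx (ext s) (B (ext s) \<omega>))" for \<omega>
  note [measurable] = B_M[OF t1T order_refl] B_M[OF t2T t12] space_measurable(1)[OF t1T] space_measurable(1)[OF t2T]
  have V_meas [measurable]: "V n \<in> borel_measurable M" for n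
    unfolding V_def by measurable
  have X_meas [measurable]: "X \<in> borel_measurable M" unfolding X_def by measurable
  have good: "AE \<omega> in M. continuous_on {t1..t2} (sample \<omega>) \<and> gap_term (sample \<omega>) summable_on gaps"
    using path_continuous gap_squares_bounded
  proof eventually_elim
    case (elim \<omega>)
    thus ?case using gap_term_summable[OF elim(1)] by blast
  qed
  have VL: "AE \<omega> in M. (\<lambda>n. V n \<omega>) \<longlonglongrightarrow> L \<omega>"
    using good
  proof eventually_elim
    case (elim \<omega>)
    have "(gap_term (sample \<omega>) has_sum infsum (gap_term (sample \<omega>)) gaps) gaps" using elim by (simp add: has_sum_infsum)
    from sum_long_gaps_tendsto[OF this] show ?case
      unfolding V_def L_def
      by (intro tendsto_intros time_sum_tendsto second_sum_tendsto) (use elim in auto)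
  qed
  have XL: "AE \<omega> in M. X \<omega> = L \<omega>"
    using VL by eventually_elim (simp add: X_def limI)
  have VX: "conv_in_prob M V X"
    by (rule conv_in_prob_AE) (use VL XL in eventually_elim, simp)
  have "conv_in_prob M (\<lambda>n \<omega>. V n \<omega> - mart_sum n (sample \<omega>) - quad_sum n (sample \<omega>) - taylor_sum n (sample \<omega>)) X"
    by (intro conv_in_prob_diff VX mart_sum_conv quad_sum_conv taylor_sum_conv) measurable
  also have "(\<lambda>n \<omega>. V n \<omega> - mart_sum n (sample \<omega>) - quad_sum n (sample \<omega>) - taylor_sum n (sample \<omega>)) = (\<lambda>n \<omega>. ito_sum n (sample \<omega>))"
  proof (intro ext)
    fix n \<omega>
    show "V n \<omega> - mart_sum n (sample \<omega>) - quad_sum n (sample \<omega>) - taylor_sum n (sample \<omega>) = ito_sum n (sample \<omega>)"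
      unfolding V_def decomposition[where n = n and b = "sample \<omega>"] by simp
  qed
  finally have SX: "conv_in_prob M (\<lambda>n \<omega>. ito_sum n (sample \<omega>)) X" .
  let ?xi = "\<lambda>n k \<omega>. fx (r n k) (B (r n k) \<omega>)"
  have "is_ito_integral M F B t1 t2 (\<lambda>s \<omega>. fx (ext s) (B (ext s) \<omega>)) X"
    unfolding is_ito_integral_def
  proof (intro conjI exI)
    show "\<forall>n. simple_adapted F t1 t2 (m n) (r n) (?xi n)"
    proof
      fix n
      show "simple_adapted F t1 t2 (m n) (r n) (?xi n)"
      proof (rule simple_adaptedI[OF part])
        fix k assume k: "k < m n"
        show "?xi n k \<in> borel_measurable (F (r n k))"
          by (rule measurable_compose[OF B_adapted space_measurable(2)]) (use part_in[OF k] in auto)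
      qed
    qed
    show "conv_in_prob M (\<lambda>n \<omega>. LBINT s:{t1..t2}. (simple_proc (m n) (r n) (?xi n) s \<omega> - fx (ext s) (B (ext s) \<omega>))\<^sup>2) (\<lambda>_. 0)"
    proof (rule conv_in_prob_AE)
      show "AE \<omega> in M. (\<lambda>n. LBINT s:{t1..t2}. (simple_proc (m n) (r n) (?xi n) s \<omega> - fx (ext s) (B (ext s) \<omega>))\<^sup>2) \<longlonglongrightarrow> 0"
        using path_continuous
      proof eventually_elim
        case (elim \<omega>)
        \<comment> \<open>With \<open>\<omega>\<close> fixed the coefficients of the simple process
          are constants, so the statement for a single path applies.\<close>
        from ito_step_square_integral[OF this, of \<omega>] show ?case by (simp add: simple_proc_def)
      qed
    qed
    show "conv_in_prob M (\<lambda>n. simple_ito B (m n) (r n) (?xi n)) X"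
      using SX by (simp add: ito_sum_def simple_ito_def[abs_def])
  qed (rule X_meas)
  moreover have "AE \<omega> in M. (gap_term (sample \<omega>) has_sum
        (f t2 (B t2 \<omega>) - f t1 (B t1 \<omega>) - (LBINT s:{t1..t2}. fd (ext s) (B (ext s) \<omega>)) - X \<omega>
         - 1/2 * (LBINT s:{t1..t2}. fxx (ext s) (B (ext s) \<omega>)))) gaps"
    using good XL
  proof eventually_elim
    case (elim \<omega>)
    have "(gap_term (sample \<omega>) has_sum infsum (gap_term (sample \<omega>)) gaps) gaps" using elim by (simp add: has_sum_infsum)
    thus ?case using elim(2) by (simp add: L_def)
  qed
  ultimately show ?thesis by blast
qed

end

theorem theorem2:
  fixes M :: "'a measure" and F :: "real \<Rightarrow> 'a measure"
    and T :: "real set" and B W :: "real \<Rightarrow> 'a \<Rightarrow> real"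
    and f fd fdd fx fxx fdx fdxx :: "real \<Rightarrow> real \<Rightarrow> real"
    and t1 t2 :: real
  assumes ts: "time_scale T"
    and bm: "brownian_motion M F B"
    and W_eq: "\<And>t \<omega>. t \<in> T \<Longrightarrow> 0 \<le> t \<Longrightarrow> W t \<omega> = B t \<omega>"
    and d1: "\<And>t x. t \<in> ts_kappa T \<Longrightarrow> has_delta_derivative T (\<lambda>s. f s x) (fd t x) t"
    and d2: "\<And>t x. t \<in> ts_kappa (ts_kappa T) \<Longrightarrow> has_delta_derivative T (\<lambda>s. fd s x) (fdd t x) t"
    and px1: "\<And>t x. t \<in> T \<Longrightarrow> ((\<lambda>y. f t y) has_real_derivative fx t x) (at x)"
    and px2: "\<And>t x. t \<in> T \<Longrightarrow> ((\<lambda>y. fx t y) has_real_derivative fxx t x) (at x)"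
    and pdx1: "\<And>t x. t \<in> ts_kappa T \<Longrightarrow> ((\<lambda>y. fd t y) has_real_derivative fdx t x) (at x)"
    and pdx2: "\<And>t x. t \<in> ts_kappa T \<Longrightarrow> ((\<lambda>y. fdx t y) has_real_derivative fdxx t x) (at x)"
    and c_fd: "continuous_on (ts_kappa T \<times> UNIV) (\<lambda>(t, x). fd t x)"
    and c_fdd: "continuous_on (ts_kappa (ts_kappa T) \<times> UNIV) (\<lambda>(t, x). fdd t x)"
    and c_fx: "continuous_on (T \<times> UNIV) (\<lambda>(t, x). fx t x)"
    and c_fxx: "continuous_on (T \<times> UNIV) (\<lambda>(t, x). fxx t x)"
    and c_fdx: "continuous_on (ts_kappa T \<times> UNIV) (\<lambda>(t, x). fdx t x)"
    and c_fdxx: "continuous_on (ts_kappa T \<times> UNIV) (\<lambda>(t, x). fdxx t x)"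
    and t1T: "t1 \<in> T" and t2T: "t2 \<in> T" and t1_nonneg: "0 \<le> t1" and t12: "t1 \<le> t2"
  shows "\<exists>X. is_ito_integral M F B t1 t2
               (\<lambda>s \<omega>. fx (ts_ext T s) (W (ts_ext T s) \<omega>)) X \<and>
         (AE \<omega> in M.
            ((\<lambda>a. f (ts_sigma T a) (W (ts_sigma T a) \<omega>) - f (ts_sigma T a) (W a \<omega>)
                   - fx a (W a \<omega>) * (W (ts_sigma T a) \<omega> - W a \<omega>)
                   - 1/2 * fxx a (W a \<omega>) * (ts_sigma T a - a))
             has_sum
               (f t2 (W t2 \<omega>) - f t1 (W t1 \<omega>)
                - (LBINT s:{t1..t2}. fd (ts_ext T s) (W (ts_ext T s) \<omega>))
                - X \<omega>
                - 1/2 * (LBINT s:{t1..t2}. fxx (ts_ext T s) (W (ts_ext T s) \<omega>))))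
            (ts_gaps_in T t1 t2))"
proof -
  have T: "closed T" using ts by (simp add: time_scale_def)
  \<comment> \<open>\<open>Suc\<close> keeps every mesh bound positive.\<close>
  let ?\<delta> = "\<lambda>n. inverse (real (Suc n))"
  have "\<forall>n. \<exists>m r. ts_partition T (?\<delta> n) t1 t2 m r"
    using ts_partition_exists[OF T _ t1T t2T t12] by simp
  then obtain m r where part: "\<And>n. ts_partition T (?\<delta> n) t1 t2 (m n) (r n)" by metis
  interpret ts_ito M F B T t1 t2 ?\<delta> m r f fd fx fxx fdx
  proof unfold_locales
    show "decseq ?\<delta>" by (auto simp: decseq_def field_simps)
    show "?\<delta> \<longlonglongrightarrow> 0" by (rule LIMSEQ_inverse_real_of_nat)
  qed (use assms T part in auto)
  obtain X where X: "is_ito_integral M F B t1 t2 (\<lambda>s \<omega>. fx (ext s) (B (ext s) \<omega>)) X"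
    "AE \<omega> in M. (gap_term (sample \<omega>) has_sum
        (f t2 (B t2 \<omega>) - f t1 (B t1 \<omega>) - (LBINT s:{t1..t2}. fd (ext s) (B (ext s) \<omega>)) - X \<omega>
         - 1/2 * (LBINT s:{t1..t2}. fxx (ext s) (B (ext s) \<omega>)))) gaps"
    using ito_formula by blast
  \<comment> \<open>\<open>W\<close> and \<open>B\<close> are known to agree at nonnegative points
    of \<open>T\<close>, and \<open>ext s\<close> is such a point for every \<open>s\<close> in
    \<open>[t1, t2]\<close>.\<close>
  have W_ext: "W (ext s) \<omega> = B (ext s) \<omega>" if "s \<in> {t1..t2}" for s \<omega>
    using ts_ext_props[OF T t1T t1_nonneg, of s] that t1_nonneg by (intro W_eq) auto
  have int_eq: "(LBINT s:{t1..t2}. h s (W (ext s) \<omega>)) = (LBINT s:{t1..t2}. h s (B (ext s) \<omega>))"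
    for h :: "real \<Rightarrow> real \<Rightarrow> real" and \<omega>
    by (rule set_lebesgue_integral_cong) (use W_ext in auto)
  \<comment> \<open>The simple integrals are formed with \<open>B\<close> itself, so the integrand
    is all that has to be rewritten.\<close>
  have "is_ito_integral M F B t1 t2 (\<lambda>s \<omega>. fx (ext s) (W (ext s) \<omega>)) X"
    using X(1) unfolding is_ito_integral_def
    by (simp only: int_eq[of "\<lambda>s x. (simple_proc _ _ _ s _ - fx (ext s) x)\<^sup>2"])
  moreover have "AE \<omega> in M.
            ((\<lambda>a. f (\<sigma> a) (W (\<sigma> a) \<omega>) - f (\<sigma> a) (W a \<omega>) - fx a (W a \<omega>) * (W (\<sigma> a) \<omega> - W a \<omega>)
                   - 1/2 * fxx a (W a \<omega>) * (\<sigma> a - a))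
             has_sum
               (f t2 (W t2 \<omega>) - f t1 (W t1 \<omega>) - (LBINT s:{t1..t2}. fd (ext s) (W (ext s) \<omega>)) - X \<omega>
                - 1/2 * (LBINT s:{t1..t2}. fxx (ext s) (W (ext s) \<omega>)))) gaps"
    using X(2)
  proof eventually_elim
    case (elim \<omega>)
    have ends: "W t1 \<omega> = B t1 \<omega>" "W t2 \<omega> = B t2 \<omega>" using W_eq t1T t2T t1_nonneg t12 by auto
    have ints: "(LBINT s:{t1..t2}. fd (ext s) (W (ext s) \<omega>)) = (LBINT s:{t1..t2}. fd (ext s) (B (ext s) \<omega>))"
      "(LBINT s:{t1..t2}. fxx (ext s) (W (ext s) \<omega>)) = (LBINT s:{t1..t2}. fxx (ext s) (B (ext s) \<omega>))"
      using int_eq[of "\<lambda>s. fd (ext s)"] int_eq[of "\<lambda>s. fxx (ext s)"] by simp_all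
    show ?case unfolding ends ints
    proof (rule has_sum_cong[THEN iffD1, OF _ elim])
      fix a assume a: "a \<in> gaps"
      have "W a \<omega> = B a \<omega>" "W (\<sigma> a) \<omega> = B (\<sigma> a) \<omega>"
        using gap_facts[OF a] by (auto intro!: W_eq)
      thus "gap_term (sample \<omega>) a = f (\<sigma> a) (W (\<sigma> a) \<omega>) - f (\<sigma> a) (W a \<omega>) - fx a (W a \<omega>) * (W (\<sigma> a) \<omega> - W a \<omega>)
                   - 1/2 * fxx a (W a \<omega>) * (\<sigma> a - a)"
        by (simp add: gap_term_def)
    qed
  qed
  ultimately show ?thesis by blast
qed

end
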